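(* Let $G$ be a compactly generated locally compact metabelian group and $(N_n)_{n\ge0}$ an ascending sequence of closed normal subgroups of $G$. Let $N=\overline{\bigcup_n N_n}$. Then there exists $n_0$ such that $N_n$ is cocompact in $N$ for all $n\ge n_0$.
   Context: A locally compact group is metabelian if its derived subgroup $[G,G]$ is abelian. Compactly generated means generated as an abstract group by a compact subset. *)

theory Defs
  imports "HOL-Analysis.Analysis" "HOL-Algebra.Algebra"
begin

definition topological_group :: "('a, 'b) monoid_scheme \<Rightarrow> 'a topology \<Rightarrow> bool" where
  "topological_group G T \<longleftrightarrow> group G \<and> topspace T = carrier G \<and>
     continuous_map (prod_topology T T) T (\<lambda>(x, y). x \<otimes>\<^bsub>G\<^esub> y) \<and>
     continuous_map T T (\<lambda>x. inv\<^bsub>G\<^esub> x)"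

definition locally_compact_group :: "('a, 'b) monoid_scheme \<Rightarrow> 'a topology \<Rightarrow> bool" where
  "locally_compact_group G T \<longleftrightarrow> topological_group G T \<and> Hausdorff_space T \<and>
     locally_compact_space T"

definition compactly_generated :: "('a, 'b) monoid_scheme \<Rightarrow> 'a topology \<Rightarrow> bool" where
  "compactly_generated G T \<longleftrightarrow> (\<exists>K. compactin T K \<and> generate G K = carrier G)"

definition metabelian :: "('a, 'b) monoid_scheme \<Rightarrow> bool" where
  "metabelian G \<longleftrightarrow> (\<forall>x \<in> derived G (carrier G). \<forall>y \<in> derived G (carrier G).
     x \<otimes>\<^bsub>G\<^esub> y = y \<otimes>\<^bsub>G\<^esub> x)"

definition cocompact_in :: "('a, 'b) monoid_scheme \<Rightarrow> 'a topology \<Rightarrow> 'a set \<Rightarrow> 'a set \<Rightarrow> bool" where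
  "cocompact_in G T H L \<longleftrightarrow> (\<exists>K. compactin T K \<and> K \<subseteq> L \<and> L = K <#>\<^bsub>G\<^esub> H)"

end

theory Submission
  imports Defs
begin

text \<open>It suffices to find, for every closed normal subgroup \<open>N\<close> of \<open>G\<close>, a compact subset of \<open>N\<close> whose
  normal closure is \<open>N\<close>: applied to the closure \<open>N\<close> of the union, a compact neighbourhood \<open>S\<close> of the
  identity in \<open>N\<close> containing this set satisfies, by density, \<open>S S \<subseteq> N\<^sub>n S\<close> and \<open>S\<^sup>k \<subseteq> N\<^sub>n S\<close> for the \<open>k\<close> in a compact
  generating set and for large \<open>n\<close>, which forces \<open>N = N\<^sub>n S\<close>.

  The existence of the compact set is a noetherian property of topological modules: in a locally compact
  abelian group with finitely many commuting automorphisms which is generated by the images of a compact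
  set, every closed invariant subgroup is generated by the images of a compact set. The proof is by
  induction on the number of automorphisms, following the proof of Hilbert's basis theorem; the ideals of
  leading coefficients are replaced by relatively open, hence closed, subgroups. Without automorphisms
  the statement is that closed subgroups of compactly generated abelian groups are compactly generated.
  Here the group is a union of translates of a compact set by \<open>\<int>\<^sup>m\<close>, and any element of the subgroup
  far from the origin can be shortened by one of finitely many others pointing in nearly the same
  direction.\<close>

section \<open>Conjugation and centralizers modulo a normal subgroup\<close>

context group
begin

definition conj_by :: "'a \<Rightarrow> 'a \<Rightarrow> 'a" where
  "conj_by g x = g \<otimes> x \<otimes> inv g"

definition comm :: "'a \<Rightarrow> 'a \<Rightarrow> 'a" where
  "comm x y = x \<otimes> y \<otimes> inv x \<otimes> inv y"

text \<open>For normal \<open>Z\<close> this is the preimage of the centralizer of the image of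
  \<open>Y\<close> in G/Z. Phrasing it by commutators avoids the quotient group.\<close>

definition centralizer_mod :: "'a set \<Rightarrow> 'a set \<Rightarrow> 'a set" where
  "centralizer_mod Z Y = {x \<in> carrier G. \<forall>y\<in>Y. comm x y \<in> Z}"

lemma mult_inv_cancel [simp]:
  assumes "x \<in> carrier G" "y \<in> carrier G"
  shows "x \<otimes> (inv x \<otimes> y) = y" "inv x \<otimes> (x \<otimes> y) = y"
  using assms by (simp_all flip: m_assoc)

lemmas word_simps = m_assoc inv_mult_group conj_by_def comm_def

lemma conj_by_closed [simp]: "g \<in> carrier G \<Longrightarrow> x \<in> carrier G \<Longrightarrow> conj_by g x \<in> carrier G"
  by (simp add: conj_by_def)

lemma comm_closed [simp]: "g \<in> carrier G \<Longrightarrow> x \<in> carrier G \<Longrightarrow> comm g x \<in> carrier G"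
  by (simp add: comm_def)

lemma conj_by_one [simp]: "x \<in> carrier G \<Longrightarrow> conj_by \<one> x = x"
  by (simp add: conj_by_def)

lemma conj_by_one_right [simp]: "g \<in> carrier G \<Longrightarrow> conj_by g \<one> = \<one>"
  by (simp add: conj_by_def)

lemma conj_by_mult:
  "g \<in> carrier G \<Longrightarrow> x \<in> carrier G \<Longrightarrow> y \<in> carrier G \<Longrightarrow> conj_by g (x \<otimes> y) = conj_by g x \<otimes> conj_by g y"
  by (simp add: word_simps)

lemma conj_by_inv:
  "g \<in> carrier G \<Longrightarrow> x \<in> carrier G \<Longrightarrow> conj_by g (inv x) = inv (conj_by g x)"
  by (simp add: word_simps)

lemma conj_by_conj_by:
  "g \<in> carrier G \<Longrightarrow> h \<in> carrier G \<Longrightarrow> x \<in> carrier G \<Longrightarrow> conj_by g (conj_by h x) = conj_by (g \<otimes> h) x"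
  by (simp add: word_simps)

lemma conj_by_inv_cancel [simp]:
  assumes "g \<in> carrier G" "x \<in> carrier G"
  shows "conj_by g (conj_by (inv g) x) = x" "conj_by (inv g) (conj_by g x) = x"
  using assms by (simp_all add: conj_by_conj_by)

lemma subgroup_conj_image:
  assumes "subgroup B G" "g \<in> carrier G"
  shows "subgroup (conj_by g ` B) G"
proof -
  interpret B: subgroup B G by fact
  show ?thesis
  proof (rule subgroupI)
    show "conj_by g ` B \<subseteq> carrier G" using assms by auto
    show "conj_by g ` B \<noteq> {}" using B.one_closed by blast
  next
    fix a assume "a \<in> conj_by g ` B"
    then show "inv a \<in> conj_by g ` B"
      using assms(2) by (auto simp flip: conj_by_inv)
  next
    fix a b assume "a \<in> conj_by g ` B" "b \<in> conj_by g ` B"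
    then show "a \<otimes> b \<in> conj_by g ` B"
      using assms(2) by (auto simp flip: conj_by_mult)
  qed
qed

lemma normal_iff_conj_by:
  "N \<lhd> G \<longleftrightarrow> subgroup N G \<and> (\<forall>g\<in>carrier G. \<forall>x\<in>N. conj_by g x \<in> N)"
  by (simp add: normal_inv_iff conj_by_def)

lemma comm_inv: "x \<in> carrier G \<Longrightarrow> y \<in> carrier G \<Longrightarrow> inv (comm x y) = comm y x"
  by (simp add: word_simps)

lemma comm_in_derived: "x \<in> H \<Longrightarrow> y \<in> H \<Longrightarrow> comm x y \<in> derived G H"
  unfolding derived_def comm_def by (rule generate.incl) blast

lemma derived_subset_iff:
  assumes "subgroup B G"
  shows "derived G (carrier G) \<subseteq> B \<longleftrightarrow> (\<forall>x\<in>carrier G. \<forall>y\<in>carrier G. comm x y \<in> B)"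
proof
  assume "\<forall>x\<in>carrier G. \<forall>y\<in>carrier G. comm x y \<in> B"
  then show "derived G (carrier G) \<subseteq> B"
    unfolding derived_def by (intro generate_subgroup_incl assms) (auto simp: comm_def)
qed (use comm_in_derived in blast)

text \<open>By normality of \<open>Z\<close> and two identities: [a^-1, y] is the conjugate of
  [a, y]^-1 by a^-1, and [a b, y] is the conjugate of [b, y] by a, times [a, y].\<close>

lemma subgroup_centralizer_mod:
  assumes "Z \<lhd> G" "Y \<subseteq> carrier G"
  shows "subgroup (centralizer_mod Z Y) G"
proof -
  interpret Z: normal Z G by fact
  have conjZ: "conj_by g z \<in> Z" if "g \<in> carrier G" "z \<in> Z" for g z
    using that assms(1) by (simp add: normal_iff_conj_by)
  show ?thesis
  proof (rule subgroupI)
    show "centralizer_mod Z Y \<subseteq> carrier G" by (auto simp: centralizer_mod_def)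
    have "\<one> \<in> centralizer_mod Z Y"
      using assms(2) by (auto simp: centralizer_mod_def comm_def subset_iff)
    then show "centralizer_mod Z Y \<noteq> {}" by blast
  next
    fix a assume a: "a \<in> centralizer_mod Z Y"
    have "comm (inv a) y \<in> Z" if "y \<in> Y" for y
    proof -
      have c: "a \<in> carrier G" "y \<in> carrier G" "comm a y \<in> Z"
        using a that assms by (auto simp: centralizer_mod_def)
      have "comm (inv a) y = conj_by (inv a) (inv (comm a y))"
        using c(1,2) by (simp add: word_simps)
      then show ?thesis using c by (simp add: conjZ)
    qed
    then show "inv a \<in> centralizer_mod Z Y" using a by (auto simp: centralizer_mod_def)
  next
    fix a b assume a: "a \<in> centralizer_mod Z Y" "b \<in> centralizer_mod Z Y"
    have "comm (a \<otimes> b) y \<in> Z" if "y \<in> Y" for y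
    proof -
      have c: "a \<in> carrier G" "b \<in> carrier G" "y \<in> carrier G" "comm a y \<in> Z" "comm b y \<in> Z"
        using a that assms by (auto simp: centralizer_mod_def)
      have "comm (a \<otimes> b) y = conj_by a (comm b y) \<otimes> comm a y"
        using c(1,2,3) by (simp add: word_simps)
      then show ?thesis using c by (simp add: conjZ)
    qed
    then show "a \<otimes> b \<in> centralizer_mod Z Y" using a by (auto simp: centralizer_mod_def)
  qed
qed

lemma centralizer_mod_sym:
  assumes "subgroup Z G" "S \<subseteq> carrier G" "Y \<subseteq> carrier G" "S \<subseteq> centralizer_mod Z Y"
  shows "Y \<subseteq> centralizer_mod Z S"
proof
  fix y assume "y \<in> Y"
  moreover have "comm y x \<in> Z" if "x \<in> S" for x
  proof -
    have "x \<in> carrier G" "y \<in> carrier G" "comm x y \<in> Z"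
      using that \<open>y \<in> Y\<close> assms by (auto simp: centralizer_mod_def)
    then show ?thesis
      using comm_inv[of x y] subgroup.m_inv_closed[OF assms(1), of "comm x y"] by simp
  qed
  ultimately show "y \<in> centralizer_mod Z S"
    using assms(3) by (auto simp: centralizer_mod_def)
qed

text \<open>Centralizers are subgroups and the relation is symmetric: pass to the generated subgroup
  on one side, swap the sides, and pass to it on the other.\<close>

lemma centralizer_mod_generate:
  assumes "Z \<lhd> G" "S \<subseteq> carrier G" "S \<subseteq> centralizer_mod Z S"
  shows "generate G S \<subseteq> centralizer_mod Z (generate G S)"
proof -
  have Z: "subgroup Z G" using assms(1) normal_imp_subgroup by blast
  have gen: "generate G S \<subseteq> carrier G" using assms(2) by (rule generate_incl)
  have "generate G S \<subseteq> centralizer_mod Z S"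
    using assms by (intro generate_subgroup_incl subgroup_centralizer_mod)
  then have "S \<subseteq> centralizer_mod Z (generate G S)"
    using centralizer_mod_sym Z gen assms(2) by blast
  then show ?thesis
    by (rule generate_subgroup_incl) (rule subgroup_centralizer_mod[OF assms(1) gen])
qed

end

section \<open>Locally compact groups\<close>

locale lc_group = group G for G :: "('a, 'b) monoid_scheme" (structure) +
  fixes T :: "'a topology"
  assumes lc: "locally_compact_group G T"
begin

lemma topspace [simp]: "topspace T = carrier G"
  using lc by (simp add: locally_compact_group_def topological_group_def)

lemma Hausdorff: "Hausdorff_space T"
  using lc by (simp add: locally_compact_group_def)

lemma continuous_mult:
  assumes "continuous_map S T f" "continuous_map S T g"
  shows "continuous_map S T (\<lambda>x. f x \<otimes> g x)"
proof -
  have m: "continuous_map (prod_topology T T) T (\<lambda>(x, y). x \<otimes> y)"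
    using lc by (simp add: locally_compact_group_def topological_group_def)
  have "continuous_map S (prod_topology T T) (\<lambda>x. (f x, g x))"
    using assms by (simp add: continuous_map_pairedI)
  from continuous_map_compose[OF this m] show ?thesis
    by (simp add: o_def)
qed

lemma continuous_inv:
  assumes "continuous_map S T f"
  shows "continuous_map S T (\<lambda>x. inv (f x))"
proof -
  have m: "continuous_map T T (\<lambda>x. inv x)"
    using lc by (simp add: locally_compact_group_def topological_group_def)
  from continuous_map_compose[OF assms m] show ?thesis
    by (simp add: o_def)
qed

lemma continuous_conj_by:
  assumes "continuous_map S T f" "continuous_map S T g"
  shows "continuous_map S T (\<lambda>x. conj_by (f x) (g x))"
  unfolding conj_by_def by (intro continuous_mult continuous_inv assms)

lemma continuous_comm:
  assumes "continuous_map S T f" "continuous_map S T g"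
  shows "continuous_map S T (\<lambda>x. comm (f x) (g x))"
  unfolding comm_def by (intro continuous_mult continuous_inv assms)

lemma compactin_subset: "compactin T K \<Longrightarrow> K \<subseteq> carrier G"
  using compactin_subset_topspace by force

lemma compactin_image2:
  assumes "compactin T K" "compactin T L"
    and "continuous_map (prod_topology T T) T (\<lambda>p. f (fst p) (snd p))"
  shows "compactin T (\<Union>k\<in>K. \<Union>l\<in>L. {f k l})"
proof -
  have "compactin (prod_topology T T) (K \<times> L)"
    using assms by (simp add: compactin_Times)
  from image_compactin[OF this assms(3)]
  have "compactin T ((\<lambda>p. f (fst p) (snd p)) ` (K \<times> L))" .
  moreover have "(\<lambda>p. f (fst p) (snd p)) ` (K \<times> L) = (\<Union>k\<in>K. \<Union>l\<in>L. {f k l})"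
    by force
  ultimately show ?thesis by simp
qed

lemma compactin_set_mult:
  assumes "compactin T K" "compactin T L"
  shows "compactin T (K <#> L)"
  unfolding set_mult_def using assms
  by (rule compactin_image2) (intro continuous_mult continuous_map_fst continuous_map_snd)

lemma compactin_conj:
  assumes "compactin T K" "compactin T L"
  shows "compactin T (\<Union>k\<in>K. \<Union>l\<in>L. {conj_by k l})"
  using assms
  by (rule compactin_image2) (intro continuous_conj_by continuous_map_fst continuous_map_snd)

lemma compactin_comm:
  assumes "compactin T K" "compactin T L"
  shows "compactin T (\<Union>k\<in>K. \<Union>l\<in>L. {comm k l})"
  using assms
  by (rule compactin_image2) (intro continuous_comm continuous_map_fst continuous_map_snd)

lemma compactin_conj_image:
  assumes "compactin T K" "g \<in> carrier G"
  shows "compactin T (conj_by g ` K)"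
  by (rule image_compactin[OF assms(1)])
     (use assms in \<open>auto intro!: continuous_conj_by\<close>)

lemma compactin_inv:
  assumes "compactin T K"
  shows "compactin T (m_inv G ` K)"
  by (rule image_compactin[OF assms]) (intro continuous_inv continuous_map_id[unfolded id_def])

lemma openin_preimage_translate:
  assumes "openin T U" "a \<in> carrier G"
  shows "openin T {x \<in> carrier G. a \<otimes> x \<in> U}"
  using openin_continuous_map_preimage[of T T "\<lambda>x. a \<otimes> x" U] assms continuous_mult[of T "\<lambda>x. a" "\<lambda>x. x"]
  by simp

lemma openin_set_mult:
  assumes "openin T U" "S \<subseteq> carrier G"
  shows "openin T (S <#> U)"
proof -
  have U: "U \<subseteq> carrier G" using openin_subset[OF assms(1)] by simp
  have "S <#> U = (\<Union>x\<in>S. {y \<in> carrier G. inv x \<otimes> y \<in> U})"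
  proof (intro subset_antisym subsetI)
    fix y assume "y \<in> S <#> U"
    then obtain x u where "x \<in> S" "u \<in> U" "y = x \<otimes> u" by (auto simp: set_mult_def)
    then show "y \<in> (\<Union>x\<in>S. {y \<in> carrier G. inv x \<otimes> y \<in> U})"
      using assms U by (auto intro!: bexI[of _ x] simp: subset_iff)
  next
    fix y assume "y \<in> (\<Union>x\<in>S. {y \<in> carrier G. inv x \<otimes> y \<in> U})"
    then obtain x where x: "x \<in> S" "y \<in> carrier G" "inv x \<otimes> y \<in> U" by auto
    then have "y = x \<otimes> (inv x \<otimes> y)" using assms by (simp add: subset_iff)
    then show "y \<in> S <#> U" using x by (auto simp: set_mult_def)
  qed
  then show ?thesis
    using assms by (auto intro!: openin_preimage_translate simp: subset_iff)
qed

lemma compact_nbhd: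
  obtains U W where "openin T U" "compactin T W" "\<one> \<in> U" "U \<subseteq> W"
    "\<forall>u\<in>U. inv u \<in> U" "\<forall>w\<in>W. inv w \<in> W"
proof -
  have "\<exists>U W. openin T U \<and> compactin T W \<and> \<one> \<in> U \<and> U \<subseteq> W"
    using lc by (simp add: locally_compact_group_def locally_compact_space_def)
  then obtain U W where UW: "openin T U" "compactin T W" "\<one> \<in> U" "U \<subseteq> W" by blast
  define U' where "U' = U \<inter> {x \<in> topspace T. inv x \<in> U}"
  define W' where "W' = W \<union> m_inv G ` W"
  have W: "W \<subseteq> carrier G" using compactin_subset UW by blast
  show ?thesis
  proof
    show "openin T U'" unfolding U'_def
      by (intro openin_Int UW openin_continuous_map_preimage[of T T] continuous_inv
            continuous_map_id[unfolded id_def])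
    show "compactin T W'" unfolding W'_def using UW by (simp add: compactin_Un compactin_inv)
    show "\<one> \<in> U'" "U' \<subseteq> W'" using UW by (auto simp: U'_def W'_def)
    show "\<forall>u\<in>U'. inv u \<in> U'" by (auto simp: U'_def)
    show "\<forall>w\<in>W'. inv w \<in> W'" using W by (auto simp: W'_def)
  qed
qed

section \<open>Closures, open subgroups and compactness\<close>

lemma subgroup_closure_of:
  assumes "subgroup B G"
  shows "subgroup (T closure_of B) G"
proof -
  interpret B: subgroup B G by fact
  have B: "B \<subseteq> T closure_of B" using closure_of_subset[of B T] B.subset by simp
  have sub: "T closure_of B \<subseteq> carrier G" using closure_of_subset_topspace[of T B] by simp
  \<comment> \<open>Products are treated one variable at a time: first with a left factor in
    \<open>B\<close>, then by taking closures in the left factor.\<close>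
  have stepl: "b \<otimes> x \<in> T closure_of B" if "b \<in> B" "x \<in> T closure_of B" for b x
  proof -
    have "(\<lambda>x. b \<otimes> x) ` (T closure_of B) \<subseteq> T closure_of ((\<lambda>x. b \<otimes> x) ` B)"
      using that by (intro continuous_map_image_closure_subset continuous_mult) auto
    also have "\<dots> \<subseteq> T closure_of B" using that by (intro closure_of_mono) auto
    finally show ?thesis using that by auto
  qed
  have step: "y \<otimes> x \<in> T closure_of B" if "y \<in> T closure_of B" "x \<in> T closure_of B" for y x
  proof -
    have "(\<lambda>y. y \<otimes> x) ` (T closure_of B) \<subseteq> T closure_of ((\<lambda>y. y \<otimes> x) ` B)"
      using that sub by (intro continuous_map_image_closure_subset continuous_mult) auto
    also have "\<dots> \<subseteq> T closure_of (T closure_of B)" using that stepl by (intro closure_of_mono) auto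
    finally show ?thesis using that by auto
  qed
  have inv: "inv x \<in> T closure_of B" if "x \<in> T closure_of B" for x
  proof -
    have "(\<lambda>x. inv x) ` (T closure_of B) \<subseteq> T closure_of ((\<lambda>x. inv x) ` B)"
      by (intro continuous_map_image_closure_subset continuous_inv) auto
    also have "\<dots> \<subseteq> T closure_of B" by (intro closure_of_mono) auto
    finally show ?thesis using that by auto
  qed
  show ?thesis
    by (rule subgroupI) (use sub B B.one_closed step inv in blast)+
qed

lemma normal_closure_of:
  assumes "B \<lhd> G"
  shows "T closure_of B \<lhd> G"
proof -
  have "conj_by g x \<in> T closure_of B" if "g \<in> carrier G" "x \<in> T closure_of B" for g x
  proof -
    have "conj_by g ` (T closure_of B) \<subseteq> T closure_of (conj_by g ` B)"
      using that by (intro continuous_map_image_closure_subset)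
        (auto intro!: continuous_conj_by)
    also have "\<dots> \<subseteq> T closure_of B"
      using assms that by (intro closure_of_mono) (auto simp: normal_iff_conj_by)
    finally show ?thesis using that by auto
  qed
  then show ?thesis
    using assms subgroup_closure_of by (simp add: normal_iff_conj_by)
qed

lemma closedin_centralizer_mod:
  assumes "closedin T Z" "Y \<subseteq> carrier G"
  shows "closedin T (centralizer_mod Z Y)"
proof (cases "Y = {}")
  case True
  then show ?thesis using closedin_topspace[of T] by (simp add: centralizer_mod_def)
next
  case False
  have "centralizer_mod Z Y = (\<Inter>y\<in>Y. {x \<in> topspace T. comm x y \<in> Z})"
    using False by (auto simp: centralizer_mod_def)
  moreover have "closedin T {x \<in> topspace T. comm x y \<in> Z}" if "y \<in> Y" for y
    using that assms
    by (intro closedin_continuous_map_preimage[of T T] continuous_comm) auto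
  ultimately show ?thesis using False by auto
qed

text \<open>The same two passes as for generated subgroups, now using that centralizers modulo a
  closed \<open>Z\<close> are closed.\<close>

lemma centralizer_mod_closure_of:
  assumes "Z \<lhd> G" "closedin T Z" "S \<subseteq> carrier G" "S \<subseteq> centralizer_mod Z S"
  shows "T closure_of S \<subseteq> centralizer_mod Z (T closure_of S)"
proof -
  have Z: "subgroup Z G" using assms(1) normal_imp_subgroup by blast
  have cl: "T closure_of S \<subseteq> carrier G" using closure_of_subset_topspace[of T S] by simp
  have "T closure_of S \<subseteq> centralizer_mod Z S"
    using assms by (intro closure_of_minimal closedin_centralizer_mod)
  then have "S \<subseteq> centralizer_mod Z (T closure_of S)"
    using centralizer_mod_sym Z cl assms(3) by blast
  then show ?thesis
    by (rule closure_of_minimal) (rule closedin_centralizer_mod[OF assms(2) cl])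
qed

text \<open>The complement of \<open>B\<close> is the union of the open sets G - H and (H - B) U.
  The second may leave \<open>H\<close> but misses \<open>B\<close>: if h u is in \<open>B\<close>,
  then u is in \<open>U \<inter> H\<close>, hence in \<open>B\<close>, and so is h.\<close>

lemma closedin_open_subgroup:
  assumes "subgroup H G" "closedin T H" "subgroup B G" "B \<subseteq> H"
    and "openin T U" "\<one> \<in> U" "U \<inter> H \<subseteq> B"
  shows "closedin T B"
proof -
  interpret H: subgroup H G by fact
  interpret B: subgroup B G by fact
  have "carrier G - B = (carrier G - H) \<union> ((H - B) <#> U)"
  proof (intro subset_antisym subsetI)
    fix x assume "x \<in> carrier G - B"
    moreover have "x \<in> (H - B) <#> U" if "x \<in> H - B"
    proof -
      have "x = x \<otimes> \<one>" using that by simp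
      then show ?thesis using that assms(6) unfolding set_mult_def by blast
    qed
    ultimately show "x \<in> (carrier G - H) \<union> ((H - B) <#> U)" by blast
  next
    fix x assume "x \<in> (carrier G - H) \<union> ((H - B) <#> U)"
    then consider "x \<in> carrier G - H" | h u where "h \<in> H - B" "u \<in> U" "x = h \<otimes> u"
      by (auto simp: set_mult_def)
    then show "x \<in> carrier G - B"
    proof cases
      case 2
      have u: "u \<in> carrier G" using 2 openin_subset[OF assms(5)] by auto
      have "x \<notin> B"
      proof
        assume x: "x \<in> B"
        have "u = inv h \<otimes> x" using 2 u by simp
        moreover have "h \<in> H" "x \<in> H" using 2 x assms(4) by auto
        ultimately have "u \<in> H" by simp
        then have "u \<in> B" using 2 assms(7) by auto
        then have "x \<otimes> inv u \<in> B" using x by simp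
        then show False using 2 u by (simp add: m_assoc)
      qed
      then show ?thesis using 2 u by simp
    qed (use assms(4) in auto)
  qed
  moreover have "openin T (carrier G - H)"
    using assms(2) by (simp add: closedin_def)
  moreover have "openin T ((H - B) <#> U)"
    using assms(5) H.subset by (intro openin_set_mult) auto
  ultimately have "openin T (topspace T - B)" by auto
  then show ?thesis by (simp add: closedin_def B.subset)
qed

lemma compactin_subset_chain:
  assumes "compactin T K" "\<And>n::nat. openin T (P n)" "\<And>n. P n \<subseteq> P (Suc n)" "K \<subseteq> (\<Union>n. P n)"
  obtains n where "K \<subseteq> P n"
proof -
  have mono: "P m \<subseteq> P n" if "m \<le> n" for m n
    using that assms(3) by (rule lift_Suc_mono_le[rotated])
  obtain \<F> where F: "finite \<F>" "\<F> \<subseteq> range P" "K \<subseteq> \<Union>\<F>"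
    using compactinD[OF assms(1), of "range P"] assms(2,4) by blast
  then obtain I where I: "finite I" "\<F> = P ` I"
    using finite_subset_image[OF F(1,2)] by blast
  \<comment> \<open>The inserted \<open>0\<close> covers an empty index set
    \<open>I\<close>.\<close>
  have "K \<subseteq> P (Max (insert 0 I))"
  proof
    fix x assume "x \<in> K"
    then obtain i where "i \<in> I" "x \<in> P i" using F I by auto
    moreover have "i \<le> Max (insert 0 I)" using I \<open>i \<in> I\<close> by simp
    ultimately show "x \<in> P (Max (insert 0 I))" using mono by blast
  qed
  then show ?thesis using that by blast
qed

text \<open>By iteration, the group generated by \<open>V\<close> is covered by the translates of \<open>V\<close> under the group
  generated by \<open>F\<close>, if \<open>V\<close> is symmetric.\<close>

lemma finite_translates:
  assumes "subgroup H G" "compactin T V" "V \<subseteq> H" "openin T U" "\<one> \<in> U" "U \<inter> H \<subseteq> V"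
  obtains F where "finite F" "F \<subseteq> H" "V <#> V \<subseteq> F <#> V"
proof -
  interpret H: subgroup H G by fact
  have U: "U \<subseteq> carrier G" using openin_subset[OF assms(4)] by simp
  have comp: "compactin T (V <#> V)" using assms by (simp add: compactin_set_mult)
  have op: "openin T S" if "S \<in> (\<lambda>h. {h} <#> U) ` H" for S
    using that assms by (auto intro: openin_set_mult)
  have VV: "V <#> V \<subseteq> H" using assms(3) by (auto simp: set_mult_def)
  have "h \<in> {h} <#> U" if "h \<in> H" for h
  proof -
    have "h = h \<otimes> \<one>" using that by simp
    then show ?thesis using assms(5) unfolding set_mult_def by blast
  qed
  then have "V <#> V \<subseteq> \<Union>((\<lambda>h. {h} <#> U) ` H)"
    using VV by blast
  from compactinD[OF comp op this] obtain \<F> where F: "finite \<F>" "\<F> \<subseteq> (\<lambda>h. {h} <#> U) ` H" "V <#> V \<subseteq> \<Union>\<F>"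
    by blast
  then obtain F where I: "finite F" "F \<subseteq> H" "\<F> = (\<lambda>h. {h} <#> U) ` F"
    using finite_subset_image[OF F(1,2)] by blast
  have "V <#> V \<subseteq> F <#> V"
  proof
    fix x assume x: "x \<in> V <#> V"
    then obtain h where "h \<in> F" "x \<in> {h} <#> U"
      using F(3) I(3) by blast
    then obtain u where hu: "h \<in> F" "u \<in> U" "x = h \<otimes> u"
      by (auto simp: set_mult_def)
    \<comment> \<open>The translates of \<open>U\<close> are by elements of the subgroup
      \<open>H\<close>, so the remaining factor \<open>u\<close> lies in \<open>H\<close> as well,
      hence in \<open>V\<close>.\<close>
    have "u = inv h \<otimes> x" using hu U I by (auto simp: subset_iff)
    moreover have "h \<in> H" "x \<in> H" using hu x VV I by auto
    ultimately have "u \<in> H" by simp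
    then have "u \<in> V" using hu assms by auto
    then show "x \<in> F <#> V" using hu by (auto simp: set_mult_def)
  qed
  then show ?thesis using that I by blast
qed

end

section \<open>A pigeonhole principle for integer vectors\<close>

text \<open>Only the coordinates below \<open>m\<close> count; the inserted \<open>0\<close>
  supplies the value for \<open>m = 0\<close>.\<close>

definition sup_norm :: "nat \<Rightarrow> (nat \<Rightarrow> int) \<Rightarrow> int" where
  "sup_norm m c = Max (insert 0 ((\<lambda>i. \<bar>c i\<bar>) ` {..<m}))"

lemma sup_norm_le_iff: "sup_norm m c \<le> h \<longleftrightarrow> 0 \<le> h \<and> (\<forall>i<m. \<bar>c i\<bar> \<le> h)"
  unfolding sup_norm_def by (subst Max_le_iff) auto

lemma sup_norm_nonneg [simp]: "0 \<le> sup_norm m c"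
  using sup_norm_le_iff by blast

lemma abs_le_sup_norm: "i < m \<Longrightarrow> \<bar>c i\<bar> \<le> sup_norm m c"
  using sup_norm_le_iff by blast

text \<open>Equality of the quotients puts x/r and y/q into one interval of length 1/2. Vectors of
  nearly the same direction thus differ by at most (r - q) + q/2; everything is doubled to stay
  within the integers.\<close>

lemma abs_diff_le_of_div_eq:
  fixes x y :: int
  assumes "0 < q" "q \<le> r" "\<bar>x\<bar> \<le> r" "\<bar>y\<bar> \<le> q" "(2 * x) div r = (2 * y) div q"
  shows "2 * \<bar>x - y\<bar> \<le> 2 * r - q"
proof -
  define k where "k = (2 * x) div r"
  have r: "0 < r" using assms by simp
  have euclid: "n div b * b \<le> n" "n < n div b * b + b" if "0 < b" for n b :: int
  proof -
    define t u where "t = n div b * b" and "u = n mod b"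
    have "n = t + u" by (simp add: t_def u_def)
    moreover have "0 \<le> u" "u < b" using that by (simp_all add: u_def)
    ultimately show "n div b * b \<le> n" "n < n div b * b + b" unfolding t_def[symmetric] by linarith+
  qed
  have x: "k * r \<le> 2 * x" "2 * x < k * r + r"
    using euclid[OF r, of "2 * x"] by (simp_all add: k_def)
  have y: "k * q \<le> 2 * y" "2 * y < k * q + q"
    using euclid[OF assms(1), of "2 * y"] by (simp_all add: k_def assms(5))
  (* The estimate comes from x - y = x (1 - q / r) + q (x / r - y / q), here multiplied by 2 r. *)
  have 1: "2 * (x * q - y * r) \<le> r * q"
  proof -
    have "2 * x * q \<le> (k * r + r) * q" using x assms(1) by (intro mult_right_mono) auto
    moreover have "k * q * r \<le> 2 * y * r" using y r by (intro mult_right_mono) auto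
    ultimately show ?thesis by (simp add: algebra_simps)
  qed
  have 2: "2 * (y * r - x * q) \<le> r * q"
  proof -
    have "2 * y * r \<le> (k * q + q) * r" using y r by (intro mult_right_mono) auto
    moreover have "k * r * q \<le> 2 * x * q" using x assms(1) by (intro mult_right_mono) auto
    ultimately show ?thesis by (simp add: algebra_simps)
  qed
  have "x \<le> r" "- x \<le> r" "0 \<le> r - q" using assms(2,3) by auto
  then have 3: "x * (r - q) \<le> r * (r - q)" "(- x) * (r - q) \<le> r * (r - q)"
    using mult_right_mono by blast+
  have "r * (2 * (x - y)) \<le> r * (2 * r - q)"
    using 1 3(1) by (simp add: algebra_simps)
  moreover have "r * (2 * (y - x)) \<le> r * (2 * r - q)"
    using 2 3(2) by (simp add: algebra_simps)
  ultimately have "2 * (x - y) \<le> 2 * r - q" "2 * (y - x) \<le> 2 * r - q"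
    using r by (simp_all only: mult_le_cancel_left_pos)
  then show ?thesis by (simp add: abs_if)
qed

text \<open>Pigeonhole on directions: vectors scaled to norm 1 fall into finitely many boxes of side
  1/2. One representative is fixed for each box that occurs, \<open>h\<close> bounds their norms,
  and a longer vector is shortened by the representative of its box. The gain is 2 because a later
  correction costs up to 1.\<close>

lemma sup_norm_decrease:
  fixes P :: "(nat \<Rightarrow> int) \<Rightarrow> bool"
  obtains h where "0 \<le> h"
    "\<And>c. P c \<Longrightarrow> h < sup_norm m c \<Longrightarrow>
      \<exists>d. P d \<and> sup_norm m d \<le> h \<and> sup_norm m (\<lambda>i. c i - d i) + 2 \<le> sup_norm m c"
proof -
  \<comment> \<open>Subtracting d shortens c by at least half the norm of d, so the threshold 4
    yields the gain 2.\<close>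
  define D where "D = {c. P c \<and> 4 \<le> sup_norm m c}"
  define dir where "dir c = restrict (\<lambda>i. (2 * c i) div sup_norm m c) {..<m}" for c
  have "dir ` D \<subseteq> PiE {..<m} (\<lambda>_. {-2..2})"
  proof clarify
    fix c assume c: "c \<in> D"
    have "(2 * c i) div sup_norm m c \<in> {-2..2}" if "i < m" for i
    proof -
      have n: "0 < sup_norm m c" "\<bar>c i\<bar> \<le> sup_norm m c"
        using c that abs_le_sup_norm by (auto simp: D_def)
      then have "((-2) * sup_norm m c) div sup_norm m c \<le> (2 * c i) div sup_norm m c"
        by (intro zdiv_mono1) auto
      then have "-2 \<le> (2 * c i) div sup_norm m c"
        using n by (subst (asm) nonzero_mult_div_cancel_right) auto
      moreover have "(2 * c i) div sup_norm m c \<le> (2 * sup_norm m c) div sup_norm m c"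
        using n by (intro zdiv_mono1) auto
      ultimately show ?thesis using n by simp
    qed
    then show "dir c \<in> PiE {..<m} (\<lambda>_. {-2..2})" by (auto simp: dir_def)
  qed
  then have fin: "finite (dir ` D)"
    by (rule finite_subset) (intro finite_PiE; simp)
  define sel where "sel k = (SOME c. c \<in> D \<and> dir c = k)" for k
  have sel: "sel (dir c) \<in> D" "dir (sel (dir c)) = dir c" if "c \<in> D" for c
    using that someI[of "\<lambda>c'. c' \<in> D \<and> dir c' = dir c" c] unfolding sel_def by auto
  \<comment> \<open>The inserted \<open>4\<close> ensures that a vector with \<open>P\<close> longer
    than \<open>h\<close> belongs to \<open>D\<close>, and gives \<open>h\<close> a value when
    \<open>D\<close> is empty.\<close>
  define h where "h = Max (insert 4 ((\<lambda>k. sup_norm m (sel k)) ` (dir ` D)))"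
  have h4: "4 \<le> h" unfolding h_def using fin by (intro Max_ge) auto
  show ?thesis
  proof
    show "0 \<le> h" using h4 by simp
    fix c assume c: "P c" "h < sup_norm m c"
    then have cD: "c \<in> D" using h4 by (simp add: D_def)
    define d where "d = sel (dir c)"
    have d: "P d" "4 \<le> sup_norm m d" "dir d = dir c"
      using sel[OF cD] by (auto simp: d_def D_def)
    have dh: "sup_norm m d \<le> h"
      unfolding h_def d_def using fin cD by (intro Max_ge) auto
    have "\<bar>c i - d i\<bar> \<le> sup_norm m c - 2" if "i < m" for i
    proof -
      have "(2 * c i) div sup_norm m c = (2 * d i) div sup_norm m d"
        using fun_cong[OF d(3), of i] that by (simp add: dir_def)
      then have "2 * \<bar>c i - d i\<bar> \<le> 2 * sup_norm m c - sup_norm m d"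
        using d(2) dh c(2) that by (intro abs_diff_le_of_div_eq) (auto intro: abs_le_sup_norm)
      then have "2 * \<bar>c i - d i\<bar> \<le> 2 * (sup_norm m c - 2)" using d(2) by simp
      then show ?thesis by (simp only: mult_le_cancel_left_pos zero_less_numeral)
    qed
    then have "sup_norm m (\<lambda>i. c i - d i) \<le> sup_norm m c - 2"
      using c(2) h4 by (simp add: sup_norm_le_iff)
    then show "\<exists>d. P d \<and> sup_norm m d \<le> h \<and> sup_norm m (\<lambda>i. c i - d i) + 2 \<le> sup_norm m c"
      using d(1) dh by (intro exI[of _ d]) auto
  qed
qed

section \<open>Abelian sections\<close>

context comm_group
begin

text \<open>The homomorphism from \<int>^m sending the i-th basis vector to \<open>a i\<close>;
  values of the exponent vector from \<open>m\<close> on are ignored.\<close>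

definition monomial :: "(nat \<Rightarrow> 'a) \<Rightarrow> nat \<Rightarrow> (nat \<Rightarrow> int) \<Rightarrow> 'a" where
  "monomial a m c = finprod G (\<lambda>i. a i [^] c i) {..<m}"

lemma monomial_closed: "a \<in> {..<m} \<rightarrow> carrier G \<Longrightarrow> monomial a m c \<in> carrier G"
  unfolding monomial_def by (intro finprod_closed) auto

lemma monomial_add:
  assumes "a \<in> {..<m} \<rightarrow> carrier G"
  shows "monomial a m (\<lambda>i. c i + d i) = monomial a m c \<otimes> monomial a m d"
proof -
  have "monomial a m (\<lambda>i. c i + d i) = finprod G (\<lambda>i. a i [^] c i \<otimes> a i [^] d i) {..<m}"
    unfolding monomial_def using assms by (intro finprod_cong') (auto simp: int_pow_mult Pi_iff)
  then show ?thesis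
    unfolding monomial_def using assms by (subst (asm) finprod_multf) auto
qed

lemma monomial_zero: "monomial a m (\<lambda>i. 0) = \<one>"
  unfolding monomial_def by simp

lemma monomial_unit:
  assumes "a \<in> {..<m} \<rightarrow> carrier G" "j < m"
  shows "monomial a m (\<lambda>i. if i = j then 1 else 0) = a j"
proof -
  have "monomial a m (\<lambda>i. if i = j then 1 else 0) = finprod G (\<lambda>i. if j = i then a i else \<one>) {..<m}"
    unfolding monomial_def using assms by (intro finprod_cong') (auto simp: Pi_iff)
  also have "\<dots> = a j" using assms by (intro finprod_singleton) auto
  finally show ?thesis .
qed

lemma monomial_cong:
  assumes "a \<in> {..<m} \<rightarrow> carrier G" "\<And>i. i < m \<Longrightarrow> c i = d i"
  shows "monomial a m c = monomial a m d"
  unfolding monomial_def using assms by (intro finprod_cong') auto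

lemma monomial_diff:
  assumes "a \<in> {..<m} \<rightarrow> carrier G"
  shows "monomial a m (\<lambda>i. c i - d i) = monomial a m c \<otimes> inv (monomial a m d)"
proof -
  have "monomial a m c = monomial a m (\<lambda>i. c i - d i) \<otimes> monomial a m d"
    using monomial_add[OF assms, of "\<lambda>i. c i - d i" d] by simp
  then show ?thesis using monomial_closed[OF assms] by (simp add: m_assoc)
qed

end

text \<open>A closed normal subgroup \<open>H\<close> together with a normal subgroup \<open>Z\<close>, not required to be closed,
  such that the abstract quotient \<open>H/Z\<close> is an abelian group on which the commutators of \<open>G\<close> act
  trivially. Working with the subgroups between \<open>Z\<close> and \<open>H\<close> avoids quotient topologies.\<close>

locale lc_section = lc_group +
  fixes H Z :: "'a set"
  assumes H_normal: "H \<lhd> G" and H_closed: "closedin T H"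
    and Z_normal: "Z \<lhd> G" and Z_le_H: "Z \<subseteq> H"
    and central: "H \<union> derived G (carrier G) \<subseteq> centralizer_mod Z H"
begin

text \<open>These are the subgroups of H/Z, represented by their preimages.\<close>

definition between :: "'a set \<Rightarrow> bool" where
  "between B \<longleftrightarrow> subgroup B G \<and> Z \<subseteq> B \<and> B \<subseteq> H"

text \<open>Inverses are included because a conjugate of \<open>B\<close> contained in
  \<open>B\<close> can be smaller than \<open>B\<close>. The invariant subgroups are the submodules
  of H/Z over the group ring of the group generated by \<open>Y\<close>.\<close>

definition invariant :: "'a set \<Rightarrow> 'a set \<Rightarrow> bool" where
  "invariant Y B \<longleftrightarrow> (\<forall>y\<in>Y. \<forall>b\<in>B. conj_by y b \<in> B \<and> conj_by (inv y) b \<in> B)"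

text \<open>\<open>N\<close> lies in the submodule generated by \<open>K\<close>. As
  \<open>K\<close> need not lie in \<open>N\<close>, the relation passes to subsets of
  \<open>N\<close>.\<close>

definition generates :: "'a set \<Rightarrow> 'a set \<Rightarrow> 'a set \<Rightarrow> bool" where
  "generates Y K N \<longleftrightarrow> (\<forall>B. between B \<and> invariant Y B \<and> K \<subseteq> B \<longrightarrow> N \<subseteq> B)"

text \<open>Closed submodules of compactly generated submodules are compactly generated. The larger
  submodule enters only through \<open>K\<close> and need not be closed.\<close>

definition noetherian :: "'a set \<Rightarrow> bool" where
  "noetherian Y \<longleftrightarrow> (\<forall>N K. between N \<and> closedin T N \<and> invariant Y N \<and>
     compactin T K \<and> K \<subseteq> H \<and> generates Y K N \<longrightarrow>
     (\<exists>K'. compactin T K' \<and> K' \<subseteq> N \<and> generates Y K' N))"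

section \<open>Subgroups between \<open>Z\<close> and \<open>H\<close>, and the case without
  automorphisms\<close>

lemma subgroup_H: "subgroup H G" and subgroup_Z: "subgroup Z G"
  using H_normal Z_normal normal_imp_subgroup by blast+

lemma H_carrier: "h \<in> H \<Longrightarrow> h \<in> carrier G"
  using subgroup.mem_carrier[OF subgroup_H] .

lemma conj_by_H: "g \<in> carrier G \<Longrightarrow> h \<in> H \<Longrightarrow> conj_by g h \<in> H"
  using H_normal by (simp add: normal_iff_conj_by)

lemma conj_by_Z: "g \<in> carrier G \<Longrightarrow> z \<in> Z \<Longrightarrow> conj_by g z \<in> Z"
  using Z_normal by (simp add: normal_iff_conj_by)

lemma betweenD:
  assumes "between B"
  shows "subgroup B G" "Z \<subseteq> B" "B \<subseteq> H" "\<one> \<in> B" "\<And>x. x \<in> B \<Longrightarrow> x \<in> carrier G"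
    "\<And>x y. x \<in> B \<Longrightarrow> y \<in> B \<Longrightarrow> x \<otimes> y \<in> B" "\<And>x. x \<in> B \<Longrightarrow> inv x \<in> B"
  using assms by (auto simp: between_def subgroup.one_closed subgroup.mem_carrier
      subgroup.m_closed subgroup.m_inv_closed)

text \<open>Exponent vectors need a genuine abelian group, so H/Z is provided without topology,
  through the rules of its projection. It is commutative since x y = [x, y] y x with [x, y] in
  \<open>Z\<close>.\<close>

lemma abelian_quotient:
  obtains Q :: "'a set monoid" and p where "comm_group Q"
    "\<forall>x\<in>H. p x \<in> carrier Q"
    "\<forall>x\<in>H. \<forall>y\<in>H. p (x \<otimes> y) = p x \<otimes>\<^bsub>Q\<^esub> p y"
    "\<forall>x\<in>H. p (inv x) = inv\<^bsub>Q\<^esub> (p x)"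
    "\<forall>z\<in>Z. p z = \<one>\<^bsub>Q\<^esub>"
    "\<forall>x\<in>H. \<forall>y\<in>H. p x = p y \<longrightarrow> x \<otimes> inv y \<in> Z"
    "\<forall>q\<in>carrier Q. \<exists>x\<in>H. p x = q"
proof -
  interpret H: subgroup H G by (rule subgroup_H)
  interpret Z: subgroup Z G by (rule subgroup_Z)
  define GH where "GH = G\<lparr>carrier := H\<rparr>"
  interpret GH: group GH unfolding GH_def by (rule subgroup_imp_group[OF subgroup_H])
  have simps: "carrier GH = H" "x \<otimes>\<^bsub>GH\<^esub> y = x \<otimes> y" "\<one>\<^bsub>GH\<^esub> = \<one>" for x y
    by (simp_all add: GH_def)
  have "Z \<lhd> GH"
    unfolding GH_def by (rule normal_restrict_supergroup[OF subgroup_H Z_normal Z_le_H])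
  then interpret Z': normal Z GH .
  define Q where "Q = GH Mod Z"
  define p where "p x = Z #>\<^bsub>GH\<^esub> x" for x
  interpret Q: group Q unfolding Q_def by (rule Z'.factorgroup_is_group)
  have hom: "p \<in> hom GH Q"
    unfolding p_def[abs_def] Q_def by (rule Z'.r_coset_hom_Mod)
  interpret p: group_hom GH Q p
    using hom GH.is_group Q.is_group by (simp add: group_hom_def group_hom_axioms_def)
  have ker: "x \<otimes> inv y \<in> Z" if "x \<in> H" "y \<in> H" "p x = p y" for x y
  proof -
    have "x \<in> Z #>\<^bsub>GH\<^esub> x" using that by (intro GH.rcos_self Z'.is_subgroup) (simp add: simps)
    then have "x \<in> Z #>\<^bsub>GH\<^esub> y" using that by (simp add: p_def)
    then obtain z where "z \<in> Z" "x = z \<otimes> y" by (auto simp: r_coset_def simps)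
    then show ?thesis using that by (simp add: m_assoc)
  qed
  have one: "p z = \<one>\<^bsub>Q\<^esub>" if "z \<in> Z" for z
    using that Z'.rcos_const by (simp add: p_def Q_def FactGroup_def)
  have surj: "\<exists>x\<in>H. p x = q" if "q \<in> carrier Q" for q
    using that by (auto simp: Q_def carrier_FactGroup p_def simps)
  have p_mult: "p (x \<otimes> y) = p x \<otimes>\<^bsub>Q\<^esub> p y" if "x \<in> H" "y \<in> H" for x y
    using p.hom_mult[of x y] that by (simp add: simps)
  have comm: "comm_group Q"
  proof (rule Q.group_comm_groupI)
    fix a b assume "a \<in> carrier Q" "b \<in> carrier Q"
    then obtain x y where xy: "x \<in> H" "y \<in> H" "a = p x" "b = p y" using surj by metis
    have "comm x y \<in> Z" using central xy by (auto simp: centralizer_mod_def)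
    moreover have "x \<otimes> y = comm x y \<otimes> (y \<otimes> x)"
      using xy by (simp add: word_simps)
    moreover have "comm x y \<in> H" "y \<otimes> x \<in> H" using calculation(1) Z_le_H xy by auto
    ultimately have "p (x \<otimes> y) = p (y \<otimes> x)"
      using p_mult[of "comm x y" "y \<otimes> x"] one[of "comm x y"] p.hom_closed[of "y \<otimes> x"]
      by (simp add: simps)
    then show "a \<otimes>\<^bsub>Q\<^esub> b = b \<otimes>\<^bsub>Q\<^esub> a" using xy p_mult by simp
  qed
  have p_inv: "p (inv x) = inv\<^bsub>Q\<^esub> (p x)" if "x \<in> H" for x
    using p.hom_inv[of x] that m_inv_consistent[OF subgroup_H that] by (simp add: simps GH_def)
  have closed: "p x \<in> carrier Q" if "x \<in> H" for x
    using p.hom_closed[of x] that by (simp add: simps)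
  show ?thesis
    by (rule that[of Q p]; intro comm ballI impI closed p_mult p_inv one ker surj; assumption)
qed

text \<open>Modulo \<open>Z\<close>, elements of \<open>N\<close> are monomials in finitely many
  fixed elements times elements of a compact \<open>V\<close>. Those with exponents bounded by
  \<open>h\<close> come from a compact set, and dividing by one of them shortens any longer
  element.\<close>

lemma noetherian_empty: "noetherian {}"
  unfolding noetherian_def
proof (intro allI impI, elim conjE)
  fix N K
  assume N: "between N" "closedin T N" and K: "compactin T K" "K \<subseteq> H" "generates {} K N"
  interpret H: subgroup H G by (rule subgroup_H)
  obtain U W where UW: "openin T U" "compactin T W" "\<one> \<in> U" "U \<subseteq> W"
    "\<forall>u\<in>U. inv u \<in> U" "\<forall>w\<in>W. inv w \<in> W"
    by (rule compact_nbhd)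
  define V where "V = K \<union> m_inv G ` K \<union> (W \<inter> H)"
  have V_compact: "compactin T V"
    unfolding V_def using K UW H_closed
    by (intro compactin_Un compactin_inv compact_Int_closedin) auto
  have V_sub: "V \<subseteq> H" using K by (auto simp: V_def)
  have V_inv: "inv v \<in> V" if "v \<in> V" for v
    using that UW(6) K(2) H_carrier by (auto simp: V_def)
  have V_one: "\<one> \<in> V" using UW by (auto simp: V_def)
  obtain F where F: "finite F" "F \<subseteq> H" "V <#> V \<subseteq> F <#> V"
    by (rule finite_translates[OF subgroup_H V_compact V_sub UW(1,3)]) (use UW(4) in \<open>auto simp: V_def\<close>)
  obtain f and m :: nat where f: "F = f ` {..<m}"
    using F(1) unfolding finite_conv_nat_seg_image lessThan_def by blast
  have fH: "f i \<in> H" if "i < m" for i using that f F(2) by auto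
  obtain Q :: "'a set monoid" and p where Q: "comm_group Q" and Qp:
    "\<forall>x\<in>H. p x \<in> carrier Q"
    "\<forall>x\<in>H. \<forall>y\<in>H. p (x \<otimes> y) = p x \<otimes>\<^bsub>Q\<^esub> p y"
    "\<forall>x\<in>H. p (inv x) = inv\<^bsub>Q\<^esub> (p x)"
    "\<forall>z\<in>Z. p z = \<one>\<^bsub>Q\<^esub>"
    "\<forall>x\<in>H. \<forall>y\<in>H. p x = p y \<longrightarrow> x \<otimes> inv y \<in> Z"
    "\<forall>q\<in>carrier Q. \<exists>x\<in>H. p x = q"
    by (rule abelian_quotient)
  have p_closed: "p x \<in> carrier Q" and p_inv: "p (inv x) = inv\<^bsub>Q\<^esub> (p x)" if "x \<in> H" for x
    using Qp that by blast+
  have p_mult: "p (x \<otimes> y) = p x \<otimes>\<^bsub>Q\<^esub> p y" and p_ker: "p x = p y \<Longrightarrow> x \<otimes> inv y \<in> Z"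
    if "x \<in> H" "y \<in> H" for x y
    using Qp that by blast+
  have p_one: "p z = \<one>\<^bsub>Q\<^esub>" if "z \<in> Z" for z
    using Qp that by blast
  have p_surj: "\<exists>x\<in>H. p x = q" if "q \<in> carrier Q" for q
    using Qp that by blast
  interpret Q: comm_group Q by (rule Q)
  define a where "a = (\<lambda>i. p (f i))"
  have a: "a \<in> {..<m} \<rightarrow> carrier Q" using fH p_closed by (auto simp: a_def)
  define \<Phi> where "\<Phi> = Q.monomial a m"
  have \<Phi>_closed [simp]: "\<Phi> c \<in> carrier Q" for c
    unfolding \<Phi>_def by (rule Q.monomial_closed[OF a])
  define unit where "unit j = (\<lambda>i. if i = j then 1 else 0 :: int)" for j :: nat
  \<comment> \<open>As V V is contained in F V, a product of two elements of \<open>V\<close> costs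
    one extra generator.\<close>
  have VV: "\<exists>j<m. \<exists>u\<in>V. p (v \<otimes> w) = \<Phi> (unit j) \<otimes>\<^bsub>Q\<^esub> p u" if vw: "v \<in> V" "w \<in> V" for v w
  proof -
    have "v \<otimes> w \<in> F <#> V" using F(3) vw by (auto simp: set_mult_def)
    then obtain j u where ju: "j < m" "u \<in> V" "v \<otimes> w = f j \<otimes> u"
      by (auto simp: set_mult_def f)
    moreover have "\<Phi> (unit j) = p (f j)"
      unfolding \<Phi>_def unit_def using Q.monomial_unit[OF a ju(1)] by (simp add: a_def)
    moreover have "f j \<in> H" "u \<in> H" using ju V_sub fH by auto
    ultimately have "p (v \<otimes> w) = \<Phi> (unit j) \<otimes>\<^bsub>Q\<^esub> p u" by (simp add: p_mult)
    then show ?thesis using ju by blast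
  qed
  \<comment> \<open>A coordinate vector \<open>c\<close> of \<open>x\<close> need not be unique,
    hence a relation.\<close>
  define rep where "rep x c \<longleftrightarrow> (\<exists>v\<in>V. p x = \<Phi> c \<otimes>\<^bsub>Q\<^esub> p v)" for x c
  have pV [simp]: "p v \<in> carrier Q" if "v \<in> V" for v
    using p_closed[of v] that V_sub by blast
  have rep_diff: "\<exists>j<m. rep (x \<otimes> inv y) (\<lambda>i. (c i - d i) + unit j i)"
    if xy: "x \<in> H" "y \<in> H" "rep x c" "rep y d" for x y c d
  proof -
    obtain v w where vw: "v \<in> V" "w \<in> V" "p x = \<Phi> c \<otimes>\<^bsub>Q\<^esub> p v" "p y = \<Phi> d \<otimes>\<^bsub>Q\<^esub> p w"
      using xy unfolding rep_def by blast
    obtain j u where ju: "j < m" "u \<in> V" "p (v \<otimes> inv w) = \<Phi> (unit j) \<otimes>\<^bsub>Q\<^esub> p u"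
      using VV[OF vw(1) V_inv[OF vw(2)]] by blast
    have vwH: "v \<in> H" "w \<in> H" using vw V_sub by auto
    have "p (x \<otimes> inv y) = \<Phi> c \<otimes>\<^bsub>Q\<^esub> p v \<otimes>\<^bsub>Q\<^esub> inv\<^bsub>Q\<^esub> (\<Phi> d \<otimes>\<^bsub>Q\<^esub> p w)"
      using xy vw by (simp add: p_mult p_inv)
    also have "\<dots> = (\<Phi> c \<otimes>\<^bsub>Q\<^esub> inv\<^bsub>Q\<^esub> (\<Phi> d)) \<otimes>\<^bsub>Q\<^esub> (p v \<otimes>\<^bsub>Q\<^esub> inv\<^bsub>Q\<^esub> (p w))"
      using vw by (simp add: Q.inv_mult Q.m_ac)
    also have "p v \<otimes>\<^bsub>Q\<^esub> inv\<^bsub>Q\<^esub> (p w) = \<Phi> (unit j) \<otimes>\<^bsub>Q\<^esub> p u"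
      using ju vwH by (simp add: p_mult p_inv)
    also have "\<Phi> c \<otimes>\<^bsub>Q\<^esub> inv\<^bsub>Q\<^esub> (\<Phi> d) = \<Phi> (\<lambda>i. c i - d i)"
      unfolding \<Phi>_def by (rule Q.monomial_diff[OF a, symmetric])
    also have "\<Phi> (\<lambda>i. c i - d i) \<otimes>\<^bsub>Q\<^esub> (\<Phi> (unit j) \<otimes>\<^bsub>Q\<^esub> p u)
        = \<Phi> (\<lambda>i. c i - d i) \<otimes>\<^bsub>Q\<^esub> \<Phi> (unit j) \<otimes>\<^bsub>Q\<^esub> p u"
      using ju by (simp add: Q.m_assoc)
    also have "\<Phi> (\<lambda>i. c i - d i) \<otimes>\<^bsub>Q\<^esub> \<Phi> (unit j) = \<Phi> (\<lambda>i. (c i - d i) + unit j i)"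
      unfolding \<Phi>_def by (rule Q.monomial_add[OF a, symmetric])
    finally show ?thesis using ju unfolding rep_def by blast
  qed
  have rep_V: "rep x (\<lambda>i. 0)" if "x \<in> V" for x
    using that Q.monomial_zero[of a m] unfolding rep_def \<Phi>_def by (intro bexI[of _ x]) auto
  have rep_Z: "rep z (\<lambda>i. 0)" if "z \<in> Z" for z
    using p_one[OF that] p_one[OF subgroup.one_closed[OF subgroup_Z]] V_one Q.monomial_zero[of a m]
    unfolding rep_def \<Phi>_def by (intro bexI[of _ \<one>]) auto
  \<comment> \<open>The elements having coordinates form a subgroup containing \<open>K\<close> and
    \<open>Z\<close>, hence containing \<open>N\<close>.\<close>
  define R where "R = {x \<in> H. \<exists>c. rep x c}"
  have R_diff: "x \<otimes> inv y \<in> R" if "x \<in> R" "y \<in> R" for x y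
    using that rep_diff[of x y] unfolding R_def by blast
  have R_one: "\<one> \<in> R" using rep_V[OF V_one] by (auto simp: R_def)
  have R_inv: "inv x \<in> R" if "x \<in> R" for x
    using R_diff[OF R_one that] that H_carrier by (auto simp: R_def)
  have "subgroup R G"
  proof (rule subgroupI)
    show "R \<subseteq> carrier G" using H_carrier by (auto simp: R_def)
    show "R \<noteq> {}" using R_one by blast
    show "inv x \<in> R" if "x \<in> R" for x using R_inv[OF that] .
    show "x \<otimes> y \<in> R" if "x \<in> R" "y \<in> R" for x y
      using R_diff[OF that(1) R_inv[OF that(2)]] that H_carrier by (auto simp: R_def)
  qed
  then have "between R"
    using rep_Z Z_le_H by (auto simp: between_def R_def)
  moreover have "K \<subseteq> R" using rep_V K(2) by (auto simp: R_def V_def)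
  ultimately have NR: "N \<subseteq> R"
    using K(3) by (auto simp: generates_def invariant_def)
  \<comment> \<open>Only vectors realized in \<open>N\<close> are considered, so that the shortening
    vector comes from an element of \<open>N\<close>.\<close>
  obtain h where h: "0 \<le> h" "\<And>c. \<exists>y\<in>N. rep y c \<Longrightarrow> h < sup_norm m c \<Longrightarrow>
      \<exists>d. (\<exists>y\<in>N. rep y d) \<and> sup_norm m d \<le> h \<and> sup_norm m (\<lambda>i. c i - d i) + 2 \<le> sup_norm m c"
    using sup_norm_decrease[of "\<lambda>c. \<exists>y\<in>N. rep y c" m] by blast
  define I where "I = PiE {..<m} (\<lambda>_. {-h..h})"
  have I: "finite I" unfolding I_def by (intro finite_PiE) auto
  obtain g where g: "\<And>c. g c \<in> H" "\<And>c. p (g c) = \<Phi> c"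
    using p_surj[OF \<Phi>_closed] by metis
  \<comment> \<open>Finitely many translates of \<open>V\<close>, by lifts to \<open>H\<close> of
    the monomials in the box, form a compact set; so does its intersection with the closed
    \<open>N\<close>.\<close>
  define K' where "K' = (\<Union>c\<in>I. {g c} <#> V) \<inter> N"
  have "compactin T (\<Union>c\<in>I. {g c} <#> V)"
    using I g(1) V_compact H_carrier
    by (intro compactin_Union) (auto intro!: compactin_set_mult)
  then have "compactin T K'"
    unfolding K'_def using N(2) by (intro compact_Int_closedin)
  moreover have "K' \<subseteq> N" by (simp add: K'_def)
  moreover have "generates {} K' N"
    unfolding generates_def
  proof (intro allI impI, elim conjE)
    fix B assume B: "between B" "K' \<subseteq> B"
    have small: "x \<in> B" if x: "x \<in> N" "rep x c" "sup_norm m c \<le> h" for x c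
    proof -
      \<comment> \<open>Truncation puts the vector into the finite set \<open>I\<close>. Then
        \<open>x\<close> differs from an element \<open>w\<close> of \<open>K'\<close> by an element
        of \<open>Z\<close>.\<close>
      define c' where "c' = restrict c {..<m}"
      have c': "c' \<in> I"
        using x(3) by (auto simp: c'_def I_def sup_norm_le_iff abs_le_iff)
      have "\<Phi> c = \<Phi> c'"
        unfolding \<Phi>_def by (rule Q.monomial_cong[OF a]) (simp add: c'_def)
      then obtain v where v: "v \<in> V" "p x = \<Phi> c' \<otimes>\<^bsub>Q\<^esub> p v" using x(2) by (auto simp: rep_def)
      define w where "w = g c' \<otimes> v"
      have H: "x \<in> H" "v \<in> H" "w \<in> H" using x(1) betweenD(3)[OF N(1)] v V_sub g(1) by (auto simp: w_def)
      then have "p x = p w" using v g by (simp add: w_def p_mult)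
      then have z: "x \<otimes> inv w \<in> Z" using p_ker H by blast
      have car: "x \<in> carrier G" "w \<in> carrier G" using H H_carrier by auto
      have "w = inv (x \<otimes> inv w) \<otimes> x" using car by (simp add: word_simps)
      moreover have "inv (x \<otimes> inv w) \<otimes> x \<in> N"
        using z betweenD(2,6,7)[OF N(1)] x(1) by blast
      ultimately have "w \<in> N" by simp
      moreover have "w \<in> {g c'} <#> V" using v by (auto simp: w_def set_mult_def)
      ultimately have "w \<in> B" using c' B(2) by (auto simp: K'_def)
      then have "x \<otimes> inv w \<otimes> w \<in> B" using z betweenD(2,6)[OF B(1)] by blast
      then show ?thesis using car by (simp add: word_simps)
    qed
    \<comment> \<open>Induction on a bound for the norm: division by \<open>y\<close> gains 2, and
      the correction \<open>unit j\<close> loses at most 1.\<close>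
    have "x \<in> B" if "x \<in> N" "rep x c" "sup_norm m c \<le> int n" for x c n
      using that
    proof (induction n arbitrary: x c)
      case 0
      then show ?case using small h(1) by force
    next
      case (Suc n)
      show ?case
      proof (cases "sup_norm m c \<le> h")
        case False
        then obtain d y where d: "y \<in> N" "rep y d" "sup_norm m d \<le> h"
            "sup_norm m (\<lambda>i. c i - d i) + 2 \<le> sup_norm m c"
          using h(2)[of c] Suc.prems by auto
        have xyH: "x \<in> H" "y \<in> H" using Suc.prems(1) d(1) betweenD(3)[OF N(1)] by auto
        obtain j where j: "j < m" "rep (x \<otimes> inv y) (\<lambda>i. (c i - d i) + unit j i)"
          using rep_diff[OF xyH Suc.prems(2) d(2)] by blast
        have "\<bar>(c i - d i) + unit j i\<bar> \<le> int n" if "i < m" for i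
          using abs_le_sup_norm[OF that, of "\<lambda>i. c i - d i"] d(4) Suc.prems(3)
          by (auto simp: unit_def)
        then have "sup_norm m (\<lambda>i. (c i - d i) + unit j i) \<le> int n"
          by (simp add: sup_norm_le_iff)
        moreover have "x \<otimes> inv y \<in> N" using betweenD[OF N(1)] Suc.prems(1) d(1) by blast
        ultimately have "x \<otimes> inv y \<in> B" using Suc.IH j by blast
        moreover have "y \<in> B" using small d by blast
        ultimately have "x \<otimes> inv y \<otimes> y \<in> B" using betweenD(6)[OF B(1)] by blast
        then show ?thesis using xyH H_carrier by (simp add: word_simps)
      qed (use small Suc.prems in blast)
    qed
    note all = this
    show "N \<subseteq> B"
    proof
      fix x assume x: "x \<in> N"
      then obtain c where "rep x c" using NR by (auto simp: R_def)
      then show "x \<in> B" using all[of x c "nat (sup_norm m c)"] x by simp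
    qed
  qed
  ultimately show "\<exists>K'. compactin T K' \<and> K' \<subseteq> N \<and> generates {} K' N" by blast
qed

section \<open>Arithmetic of invariant subgroups\<close>

lemma between_H: "between H"
  using subgroup_H Z_le_H by (simp add: between_def)

lemma invariant_H: "Y \<subseteq> carrier G \<Longrightarrow> invariant Y H"
  using conj_by_H by (auto simp: invariant_def)

text \<open>\<open>H\<close> acts trivially on H/Z: h b h^-1 = [h, b] b with [h, b] in
  \<open>Z\<close>.\<close>

lemma conj_by_H_between:
  assumes "between B" "h \<in> H" "b \<in> B"
  shows "conj_by h b \<in> B"
proof -
  have car: "h \<in> carrier G" "b \<in> carrier G" "b \<in> H" 
    using assms betweenD(3,5)[OF assms(1)] H_carrier by auto
  have "comm h b \<in> Z" using central assms(2) car(3) by (auto simp: centralizer_mod_def)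
  then have "comm h b \<otimes> b \<in> B" using betweenD(2,6)[OF assms(1)] assms(3) by blast
  then show ?thesis using car by (simp add: word_simps)
qed

text \<open>The actions of g and h on H/Z commute, since g h = [g, h] h g and commutators act
  trivially by \<open>central\<close>. This makes the acting ring commutative.\<close>

lemma conj_by_swap:
  assumes "between B" "g \<in> carrier G" "h \<in> carrier G" "x \<in> H" "conj_by g (conj_by h x) \<in> B"
  shows "conj_by h (conj_by g x) \<in> B"
proof -
  define w where "w = conj_by h (conj_by g x)"
  define d where "d = comm g h"
  have x: "x \<in> carrier G" using assms(4) H_carrier by blast
  have w: "w \<in> H" "w \<in> carrier G" using assms conj_by_H H_carrier by (auto simp: w_def)
  have d: "d \<in> derived G (carrier G)" "d \<in> carrier G"
    using assms(2,3) comm_in_derived by (auto simp: d_def)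
  have "comm d w \<in> Z" using central d(1) w(1) by (auto simp: centralizer_mod_def)
  moreover have "conj_by d w = conj_by g (conj_by h x)"
    using assms(2,3) x by (simp add: d_def w_def word_simps)
  ultimately have "inv (comm d w) \<otimes> conj_by d w \<in> B"
    using betweenD(2,6,7)[OF assms(1)] assms(5) by auto
  moreover have "inv (comm d w) \<otimes> conj_by d w = w" using d w by (simp add: word_simps)
  ultimately show ?thesis by (simp add: w_def)
qed

text \<open>Subgroups between \<open>Z\<close> and \<open>H\<close> are normalized by
  \<open>H\<close>, so factors can be moved past each other.\<close>

lemma between_set_mult:
  assumes A: "between A" and B: "between B"
  shows "between (A <#> B)"
proof -
  have sub: "A <#> B \<subseteq> H"
    using betweenD(3)[OF A] betweenD(3)[OF B] subgroup.m_closed[OF subgroup_H]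
    by (auto simp: set_mult_def)
  have AB: "\<exists>a b. a \<in> A \<and> b \<in> B \<and> x = a \<otimes> b \<and> a \<in> carrier G \<and> b \<in> carrier G \<and> a \<in> H"
    if "x \<in> A <#> B" for x
    using that betweenD(3,5)[OF A] betweenD(5)[OF B] unfolding set_mult_def by blast
  have I: "a \<otimes> b \<in> A <#> B" if "a \<in> A" "b \<in> B" for a b
    using that by (auto simp: set_mult_def)
  have "subgroup (A <#> B) G"
  proof (rule subgroupI)
    show "A <#> B \<subseteq> carrier G" using sub H_carrier by blast
    show "A <#> B \<noteq> {}" using I betweenD(4)[OF A] betweenD(4)[OF B] by blast
  next
    fix x assume "x \<in> A <#> B"
    then obtain a b where ab: "a \<in> A" "b \<in> B" "x = a \<otimes> b" "a \<in> carrier G" "b \<in> carrier G" "a \<in> H"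
      using AB by blast
    have "inv x = inv a \<otimes> conj_by a (inv b)"
      using ab by (simp add: word_simps)
    moreover have "conj_by a (inv b) \<in> B"
      using conj_by_H_between[OF B ab(6)] betweenD(7)[OF B ab(2)] by blast
    ultimately show "inv x \<in> A <#> B" using I betweenD(7)[OF A ab(1)] by simp
  next
    fix x y assume "x \<in> A <#> B" "y \<in> A <#> B"
    then obtain a b c d where ab: "a \<in> A" "b \<in> B" "x = a \<otimes> b" "a \<in> carrier G" "b \<in> carrier G" "a \<in> H"
      and cd: "c \<in> A" "d \<in> B" "y = c \<otimes> d" "c \<in> carrier G" "d \<in> carrier G" "c \<in> H"
      using AB by metis
    have "x \<otimes> y = (a \<otimes> c) \<otimes> (conj_by (inv c) b \<otimes> d)"
      using ab cd by (simp add: word_simps)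
    moreover have "conj_by (inv c) b \<in> B"
      using conj_by_H_between[OF B _ ab(2)] betweenD(7)[OF between_H cd(6)] by blast
    ultimately show "x \<otimes> y \<in> A <#> B"
      using I betweenD(6)[OF A ab(1) cd(1)] betweenD(6)[OF B _ cd(2)] by simp
  qed
  moreover have "Z \<subseteq> A <#> B"
  proof
    fix z assume "z \<in> Z"
    then have "z = z \<otimes> \<one>" "z \<in> A" using betweenD[OF A] by auto
    then show "z \<in> A <#> B" using I[of z \<one>] betweenD(4)[OF B] by simp
  qed
  ultimately show ?thesis using sub by (simp add: between_def)
qed

lemma subset_set_mult_left:
  assumes "between A" "between B"
  shows "A \<subseteq> A <#> B"
proof
  fix x assume "x \<in> A"
  moreover have "x = x \<otimes> \<one>" using betweenD(5)[OF assms(1)] \<open>x \<in> A\<close> by simp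
  ultimately show "x \<in> A <#> B" using betweenD(4)[OF assms(2)] unfolding set_mult_def by blast
qed

lemma subset_set_mult_right:
  assumes "between A" "between B"
  shows "B \<subseteq> A <#> B"
proof
  fix x assume "x \<in> B"
  moreover have "x = \<one> \<otimes> x" using betweenD(5)[OF assms(2)] \<open>x \<in> B\<close> by simp
  ultimately show "x \<in> A <#> B" using betweenD(4)[OF assms(1)] unfolding set_mult_def by blast
qed

lemma set_mult_subset_between:
  assumes "between C" "A \<subseteq> C" "B \<subseteq> C"
  shows "A <#> B \<subseteq> C"
  using assms betweenD(6)[OF assms(1)] by (auto simp: set_mult_def)

lemma invariant_set_mult:
  assumes "between A" "between B" "invariant Y A" "invariant Y B" "Y \<subseteq> carrier G"
  shows "invariant Y (A <#> B)"
proof -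
  have "conj_by g (a \<otimes> b) \<in> A <#> B"
    if "g \<in> carrier G" "conj_by g a \<in> A" "conj_by g b \<in> B" "a \<in> A" "b \<in> B" for g a b
    using that betweenD(5)[OF assms(1)] betweenD(5)[OF assms(2)]
    by (auto simp: conj_by_mult set_mult_def)
  then show ?thesis
    using assms(3-5) unfolding invariant_def set_mult_def by (auto simp: subset_iff)
qed

lemma between_conj_image:
  assumes "between B" "g \<in> carrier G"
  shows "between (conj_by g ` B)"
proof -
  have "z \<in> conj_by g ` B" if "z \<in> Z" for z
  proof
    have "z \<in> carrier G" using that Z_le_H H_carrier by blast
    then show "z = conj_by g (conj_by (inv g) z)" using assms(2) by simp
    show "conj_by (inv g) z \<in> B" using conj_by_Z[of "inv g" z] that assms(2) betweenD(2)[OF assms(1)] by auto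
  qed
  moreover have "subgroup (conj_by g ` B) G"
    by (rule subgroup_conj_image[OF betweenD(1)[OF assms(1)] assms(2)])
  moreover have "conj_by g ` B \<subseteq> H"
    using betweenD(3)[OF assms(1)] conj_by_H[OF assms(2)] by auto
  ultimately show ?thesis by (auto simp: between_def)
qed

text \<open>Since all actions on H/Z commute, translating a submodule by \<open>g\<close> gives a
  submodule.\<close>

lemma invariant_conj_image:
  assumes "between B" "g \<in> carrier G" "invariant Y B" "Y \<subseteq> carrier G"
  shows "invariant Y (conj_by g ` B)"
proof -
  have "conj_by h (conj_by g b) \<in> conj_by g ` B"
    if "b \<in> B" "h \<in> carrier G" "conj_by h b \<in> B" for h b
    using that betweenD(3)[OF assms(1)] assms(2)
    by (intro conj_by_swap[OF between_conj_image[OF assms(1,2)], of g h b]) auto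
  then show ?thesis
    using assms(3,4) unfolding invariant_def by (auto simp: subset_iff)
qed

lemma invariant_Int: "invariant Y A \<Longrightarrow> invariant Y B \<Longrightarrow> invariant Y (A \<inter> B)"
  by (auto simp: invariant_def)

lemma between_Int: "between A \<Longrightarrow> between B \<Longrightarrow> between (A \<inter> B)"
  by (auto simp: between_def intro: subgroups_Inter_pair)

text \<open>The submodule generated by \<open>S\<close>. This reading needs
  \<open>S \<subseteq> H\<close>; otherwise the family is empty and its intersection is
  everything.\<close>

definition inv_hull :: "'a set \<Rightarrow> 'a set \<Rightarrow> 'a set" where
  "inv_hull Y S = \<Inter>{B. between B \<and> invariant Y B \<and> S \<subseteq> B}"

lemma inv_hull_least: "between B \<Longrightarrow> invariant Y B \<Longrightarrow> S \<subseteq> B \<Longrightarrow> inv_hull Y S \<subseteq> B"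
  by (auto simp: inv_hull_def)

lemma inv_hull_superset: "S \<subseteq> inv_hull Y S"
  by (auto simp: inv_hull_def)

lemma
  assumes "S \<subseteq> H" "Y \<subseteq> carrier G"
  shows between_inv_hull: "between (inv_hull Y S)" and invariant_inv_hull: "invariant Y (inv_hull Y S)"
proof -
  have H: "H \<in> {B. between B \<and> invariant Y B \<and> S \<subseteq> B}"
    using assms between_H invariant_H by blast
  have "subgroup (inv_hull Y S) G"
    unfolding inv_hull_def using H by (intro subgroups_Inter) (auto simp: between_def)
  then show "between (inv_hull Y S)"
    using H by (auto simp: between_def inv_hull_def)
  show "invariant Y (inv_hull Y S)" by (auto simp: invariant_def inv_hull_def)
qed

section \<open>Ascending chains and the adjunction of one automorphism\<close>

lemma generates_mono: "generates Y K N \<Longrightarrow> M \<subseteq> N \<Longrightarrow> generates Y K M"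
  by (auto simp: generates_def)

lemma noetherianD:
  assumes "noetherian Y" "between N" "closedin T N" "invariant Y N"
    "compactin T K" "K \<subseteq> H" "generates Y K N"
  obtains K' where "compactin T K'" "K' \<subseteq> N" "generates Y K' N"
  using assms unfolding noetherian_def by metis

text \<open>An ascending union of relatively open subgroups is closed, hence compactly generated, so it is
  reached after finitely many steps.\<close>

lemma open_chain_stabilizes:
  assumes noeth: "noetherian Y"
    and P: "\<And>n::nat. between (P n)" "\<And>n. invariant Y (P n)" "\<And>n. P n \<subseteq> P (Suc n)"
    and U: "\<And>n. openin T (U n)" "\<And>n. \<one> \<in> U n" "\<And>n. U n \<inter> H \<subseteq> P n"
    and K: "compactin T K" "K \<subseteq> H" "\<And>n. generates Y K (P n)"
  shows "\<exists>n. \<forall>k. P k \<subseteq> P n"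
proof -
  have mono: "P k \<subseteq> P n" if "k \<le> n" for k n
    using that P(3) by (rule lift_Suc_mono_le[rotated])
  define J where "J = (\<Union>n. P n)"
  have pair: "\<exists>n. x \<in> P n \<and> y \<in> P n" if xy: "x \<in> J" "y \<in> J" for x y
  proof -
    obtain k l where "x \<in> P k" "y \<in> P l" using xy by (auto simp: J_def)
    then show ?thesis using mono[of k "max k l"] mono[of l "max k l"] by auto
  qed
  have "subgroup J G"
  proof (rule subgroupI)
    show "J \<subseteq> carrier G" using betweenD(5)[OF P(1)] by (auto simp: J_def)
    show "J \<noteq> {}" using betweenD(4)[OF P(1)] by (auto simp: J_def)
    show "inv x \<in> J" if "x \<in> J" for x using that betweenD(7)[OF P(1)] by (auto simp: J_def)
    show "x \<otimes> y \<in> J" if xy: "x \<in> J" "y \<in> J" for x y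
      using pair[OF xy] betweenD(6)[OF P(1)] by (auto simp: J_def)
  qed
  then have J: "between J"
    using betweenD(2,3)[OF P(1)] by (auto simp: between_def J_def)
  \<comment> \<open>\<open>J\<close> contains \<open>U 0 \<inter> H\<close>, so it is relatively
    open in \<open>H\<close> and therefore closed.\<close>
  have "closedin T J"
    by (rule closedin_open_subgroup[OF subgroup_H H_closed betweenD(1,3)[OF J] U(1,2)[of 0]])
       (use U(3) in \<open>auto simp: J_def\<close>)
  moreover have "invariant Y J" using P(2) by (auto simp: invariant_def J_def)
  moreover have "generates Y K J" using K(3) by (auto simp: generates_def J_def)
  ultimately obtain K' where K': "compactin T K'" "K' \<subseteq> J" "generates Y K' J"
    using noetherianD[OF noeth J _ _ K(1,2)] by blast
  \<comment> \<open>\<open>P k\<close> is open only relative to \<open>H\<close>, whereas P k U k is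
    open in \<open>G\<close> and meets \<open>H\<close> in \<open>P k\<close>. The union over k
    \<le> n keeps the sets increasing even if the \<open>U k\<close> shrink.\<close>
  define O' where "O' n = (\<Union>k\<le>n. P k <#> U k)" for n
  have "openin T (O' n)" for n
    unfolding O'_def using U(1) betweenD(5)[OF P(1)] by (auto intro!: openin_set_mult)
  moreover have "O' n \<subseteq> O' (Suc n)" for n
    unfolding O'_def by (intro UN_mono) auto
  moreover have "K' \<subseteq> (\<Union>n. O' n)"
  proof
    fix x assume "x \<in> K'"
    then obtain n where n: "x \<in> P n" using K'(2) by (auto simp: J_def)
    then have "x = x \<otimes> \<one>" using betweenD(5)[OF P(1)] by auto
    then have "x \<in> P n <#> U n" using n U(2) unfolding set_mult_def by blast
    then show "x \<in> (\<Union>n. O' n)" by (auto simp: O'_def)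
  qed
  ultimately obtain n where n: "K' \<subseteq> O' n"
    using compactin_subset_chain[OF K'(1), of O'] by blast
  have "K' \<subseteq> P n"
  proof
    fix x assume x: "x \<in> K'"
    then obtain k a u where k: "k \<le> n" "a \<in> P k" "u \<in> U k" "x = a \<otimes> u"
      using n by (force simp: O'_def set_mult_def)
    have car: "a \<in> carrier G" "u \<in> carrier G"
      using k betweenD(5)[OF P(1)] openin_subset[OF U(1)] by auto
    have "x \<in> H" "a \<in> H" using x K'(2) betweenD(3)[OF J] k betweenD(3)[OF P(1)] by auto
    then have "inv a \<otimes> x \<in> H" using betweenD(6,7)[OF between_H] by blast
    then have "u \<in> H" using k car by simp
    then have "u \<in> P k" using U(3) k by blast
    then have "x \<in> P k" using k betweenD(6)[OF P(1)] by blast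
    then show "x \<in> P n" using mono[OF k(1)] by blast
  qed
  then have "J \<subseteq> P n"
    using K'(3) P(1,2) unfolding generates_def by blast
  then show ?thesis by (auto simp: J_def)
qed

text \<open>The topological counterpart of Hilbert's basis theorem: \<open>B n\<close> plays the role of the polynomials of
  degree at most \<open>n\<close> in \<open>t\<close>, with coefficients in \<open>A\<close>, and \<open>J n\<close> consists of the leading
  coefficients of the elements of \<open>N\<close> of degree \<open>n + 1\<close>.\<close>

lemma noetherian_insert:
  assumes noeth: "noetherian Y" and Y: "Y \<subseteq> carrier G" and t: "t \<in> carrier G"
  shows "noetherian (insert t Y)"
  unfolding noetherian_def
proof (intro allI impI, elim conjE)
  fix N K
  assume N: "between N" "closedin T N" "invariant (insert t Y) N"
    and K: "compactin T K" "K \<subseteq> H" "generates (insert t Y) K N"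
  obtain U W where UW: "openin T U" "compactin T W" "\<one> \<in> U" "U \<subseteq> W"
    "\<forall>u\<in>U. inv u \<in> U" "\<forall>w\<in>W. inv w \<in> W"
    by (rule compact_nbhd)
  \<comment> \<open>Adding a neighbourhood of the identity in \<open>H\<close> makes every subgroup
    between \<open>A\<close> and \<open>H\<close> relatively open.\<close>
  define S where "S = K \<union> (W \<inter> H)"
  have S: "compactin T S" "S \<subseteq> H"
    unfolding S_def using K UW H_closed by (auto intro!: compactin_Un compact_Int_closedin)
  define A where "A = inv_hull Y S"
  have A: "between A" "invariant Y A"
    unfolding A_def using between_inv_hull invariant_inv_hull S(2) Y by blast+
  have UA: "U \<inter> H \<subseteq> A"
    using inv_hull_superset[of S Y] UW(4) by (auto simp: A_def S_def)
  define c where "c n = conj_by (t [^] (n::nat))" for n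
  have tn: "t [^] (n::nat) \<in> carrier G" for n using t by simp
  have c_carrier: "c n x \<in> carrier G" if "x \<in> carrier G" for n x using that t by (simp add: c_def)
  have c_H: "c n x \<in> H" if "x \<in> H" for n x using that t conj_by_H by (simp add: c_def)
  have c_Suc: "c (Suc n) x = conj_by t (c n x)" if "x \<in> carrier G" for n x
    unfolding c_def using that t nat_pow_Suc2[OF t] by (simp add: conj_by_conj_by del: nat_pow_Suc)
  have c_Suc': "c (Suc n) x = c n (conj_by t x)" if "x \<in> carrier G" for n x
    unfolding c_def using that t by (simp add: conj_by_conj_by)
  have c_0: "c 0 x = x" if "x \<in> carrier G" for x using that by (simp add: c_def)
  have c_mult: "c n (x \<otimes> y) = c n x \<otimes> c n y" if "x \<in> carrier G" "y \<in> carrier G" for n x y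
    unfolding c_def using that t by (simp add: conj_by_mult)
  have c_inv: "c n (inv x) = inv (c n x)" if "x \<in> carrier G" for n x
    unfolding c_def using that t by (simp add: conj_by_inv)
  define B where "B = rec_nat A (\<lambda>n Bn. c (Suc n) ` A <#> Bn)"
  have B_0: "B 0 = A" and B_Suc: "B (Suc n) = c (Suc n) ` A <#> B n" for n
    by (simp_all add: B_def)
  have cA: "between (c n ` A)" "invariant Y (c n ` A)" for n
    unfolding c_def using between_conj_image[OF A(1) tn] invariant_conj_image[OF A(1) tn A(2) Y] by auto
  have B: "between (B n)" "invariant Y (B n)" for n
    by (induction n)
       (auto simp: B_0 B_Suc intro: A cA between_set_mult invariant_set_mult[OF _ _ _ _ Y])
  have B_mono1: "B n \<subseteq> B (Suc n)" for n
    unfolding B_Suc by (rule subset_set_mult_right[OF cA(1) B(1)])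
  have B_mono: "B k \<subseteq> B n" if "k \<le> n" for k n
    using that B_mono1 by (rule lift_Suc_mono_le[rotated])
  have AB: "A \<subseteq> B n" for n using B_mono[of 0 n] by (simp add: B_0)
  have tA: "c n a \<in> B n" if "a \<in> A" for n a
  proof (cases n)
    case 0 then show ?thesis using that betweenD(5)[OF A(1)] by (simp add: B_0 c_0)
  next
    case (Suc k)
    then show ?thesis
      using that subset_set_mult_left[OF cA(1) B(1), of "Suc k" k] by (auto simp: B_Suc)
  qed
  have tB: "conj_by t x \<in> B (Suc n)" if "x \<in> B n" for n x
    using that
  proof (induction n arbitrary: x)
    case 0
    then have "conj_by t x = c 1 x" using betweenD(5)[OF A(1)] t by (simp add: B_0 c_def)
    then show ?case using tA[of x 1] 0 by (simp add: B_0)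
  next
    case (Suc n)
    then obtain a b where ab: "a \<in> A" "b \<in> B n" "x = c (Suc n) a \<otimes> b"
      by (auto simp: B_Suc set_mult_def)
    have car: "a \<in> carrier G" "b \<in> carrier G" using ab betweenD(5)[OF A(1)] betweenD(5)[OF B(1)] by auto
    have "conj_by t x = c (Suc (Suc n)) a \<otimes> conj_by t b"
      using ab car t c_carrier by (simp add: conj_by_mult c_Suc)
    moreover have "c (Suc (Suc n)) a \<in> B (Suc (Suc n))" using tA[OF ab(1)] .
    moreover have "conj_by t b \<in> B (Suc (Suc n))"
      using Suc.IH[OF ab(2)] B_mono1 by blast
    ultimately show ?case using betweenD(6)[OF B(1)] by simp
  qed
  have cB: "c k x \<in> B (n + k)" if "x \<in> B n" for n k x
  proof (induction k)
    case 0 then show ?case using that betweenD(5)[OF B(1)] by (simp add: c_0)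
  next
    case (Suc k) then show ?case using tB betweenD(5)[OF B(1) that] by (simp add: c_Suc)
  qed
  define SB where "SB n = (\<Union>k\<le>n. c k ` S)" for n
  have SB: "compactin T (SB n)" "SB n \<subseteq> H" for n
  proof -
    show "compactin T (SB n)"
      unfolding SB_def c_def using compactin_conj_image[OF S(1) tn] by (intro compactin_Union) auto
    show "SB n \<subseteq> H" unfolding SB_def using S(2) c_H by blast
  qed
  \<comment> \<open>Conjugating \<open>D\<close> back by t^-k gives a \<open>Y\<close>-invariant
    subgroup containing \<open>S\<close>, hence \<open>A\<close>; this uses that \<open>t\<close>
    and \<open>Y\<close> commute modulo \<open>Z\<close>.\<close>
  have gen_cA: "c k ` A \<subseteq> D" if D: "between D" "invariant Y D" "c k ` S \<subseteq> D" for k D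
  proof -
    let ?D = "conj_by (inv (t [^] k)) ` D"
    have itk: "inv (t [^] k) \<in> carrier G" using t by simp
    have "s \<in> ?D" if "s \<in> S" for s
    proof
      show "s = conj_by (inv (t [^] k)) (c k s)"
        using that S(2) H_carrier t by (auto simp: c_def)
      show "c k s \<in> D" using that D(3) by blast
    qed
    then have "A \<subseteq> ?D"
      unfolding A_def
      by (intro inv_hull_least between_conj_image[OF D(1) itk] invariant_conj_image[OF D(1) itk D(2) Y]) auto
    then show ?thesis using betweenD(5)[OF D(1)] t by (auto simp: c_def)
  qed
  have gen_B: "generates Y (SB n) (B n)" for n
    unfolding generates_def
  proof (intro allI impI, elim conjE)
    fix D assume D: "between D" "invariant Y D" "SB n \<subseteq> D"
    have cAD: "c k ` A \<subseteq> D" if "k \<le> n" for k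
      using that D(3) by (intro gen_cA D(1,2)) (auto simp: SB_def)
    have "B k \<subseteq> D" if "k \<le> n" for k
      using that
    proof (induction k)
      case 0
      have "c 0 ` A = A" using c_0 betweenD(5)[OF A(1)] by (auto simp: image_iff)
      then show ?case using cAD[of 0] by (simp add: B_0)
    next
      case (Suc k)
      then show ?case unfolding B_Suc by (intro set_mult_subset_between[OF D(1)] cAD) auto
    qed
    then show "B n \<subseteq> D" by blast
  qed
  have N_Y: "invariant Y N" using N(3) by (simp add: invariant_def)
  have N_t: "conj_by t x \<in> N" "conj_by (inv t) x \<in> N" if "x \<in> N" for x
    using N(3) that by (auto simp: invariant_def)
  have NB: "between (N <#> B n)" "invariant Y (N <#> B n)" for n
    using between_set_mult[OF N(1) B(1)] invariant_set_mult[OF N(1) B(1) N_Y B(2) Y] by auto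
  define J where "J n = {a \<in> A. c (Suc n) a \<in> N <#> B n}" for n
  have J_sub: "J n \<subseteq> A" for n by (auto simp: J_def)
  have J_between: "between (J n)" for n
  proof -
    have "subgroup (J n) G"
    proof (rule subgroupI)
      show "J n \<subseteq> carrier G" using betweenD(5)[OF A(1)] by (auto simp: J_def)
      have "c (Suc n) \<one> = \<one>" using t by (simp add: c_def)
      then show "J n \<noteq> {}" using betweenD(4)[OF A(1)] betweenD(4)[OF NB(1)] by (auto simp: J_def)
      show "inv x \<in> J n" if "x \<in> J n" for x
        using that betweenD(5,7)[OF A(1)] betweenD(7)[OF NB(1)] by (auto simp: J_def c_inv)
      show "x \<otimes> y \<in> J n" if "x \<in> J n" "y \<in> J n" for x y
        using that betweenD(5,6)[OF A(1)] betweenD(6)[OF NB(1)] by (auto simp: J_def c_mult)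
    qed
    moreover have "Z \<subseteq> J n"
    proof
      fix z assume "z \<in> Z"
      then have "c (Suc n) z \<in> Z" using conj_by_Z t unfolding c_def by blast
      then show "z \<in> J n" using \<open>z \<in> Z\<close> betweenD(2)[OF A(1)] betweenD(2)[OF NB(1)] by (auto simp: J_def)
    qed
    ultimately show ?thesis using J_sub betweenD(3)[OF A(1)] by (auto simp: between_def)
  qed
  have J_inv: "invariant Y (J n)" for n
  proof -
    have "conj_by y a \<in> J n"
      if "y \<in> carrier G" "a \<in> J n" "conj_by y a \<in> A" "conj_by y (c (Suc n) a) \<in> N <#> B n" for y a
    proof -
      have "a \<in> H" using that J_sub betweenD(3)[OF A(1)] by blast
      then have "c (Suc n) (conj_by y a) \<in> N <#> B n"
        using that(4) conj_by_swap[OF NB(1) that(1) tn] unfolding c_def by blast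
      then show ?thesis using that by (auto simp: J_def)
    qed
    then show ?thesis
      using A(2) NB(2)[of n] Y unfolding invariant_def by (auto simp: J_def subset_iff)
  qed
  have J_mono: "J n \<subseteq> J (Suc n)" for n
  proof
    fix a assume a: "a \<in> J n"
    then obtain y b where yb: "y \<in> N" "b \<in> B n" "c (Suc n) a = y \<otimes> b" and aA: "a \<in> A"
      by (auto simp: J_def set_mult_def)
    have car: "a \<in> carrier G" "y \<in> carrier G" "b \<in> carrier G"
      using aA yb betweenD(5)[OF A(1)] betweenD(5)[OF N(1)] betweenD(5)[OF B(1)] by auto
    have "c (Suc (Suc n)) a = conj_by t y \<otimes> conj_by t b"
      using car t by (simp add: c_Suc[of a "Suc n"] yb(3) conj_by_mult)
    then show "a \<in> J (Suc n)"
      using aA N_t(1)[OF yb(1)] tB[OF yb(2)] by (auto simp: J_def set_mult_def)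
  qed
  \<comment> \<open>If x in \<open>H\<close> and its conjugate by t^(n+1) both lie in
    \<open>U\<close>, then both lie in \<open>A\<close>, so x is in \<open>J n\<close>. The
    neighbourhood depends on \<open>n\<close> because conjugation need not preserve
    \<open>U\<close>.\<close>
  define O' where "O' n = U \<inter> {x \<in> topspace T. c (Suc n) x \<in> U}" for n
  have O_open: "openin T (O' n)" for n
    unfolding O'_def c_def using t UW(1)
    by (intro openin_Int openin_continuous_map_preimage[of T T] continuous_conj_by) auto
  have O_one: "\<one> \<in> O' n" for n using UW(3) t by (auto simp: O'_def c_def)
  have O_J: "O' n \<inter> H \<subseteq> J n" for n
  proof
    fix x assume x: "x \<in> O' n \<inter> H"
    then have "x \<in> A" "c (Suc n) x \<in> A" using UA c_H by (auto simp: O'_def)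
    moreover have "A \<subseteq> N <#> B n"
      using AB subset_set_mult_right[OF N(1) B(1)] by blast
    ultimately show "x \<in> J n" by (auto simp: J_def)
  qed
  \<comment> \<open>Every \<open>J n\<close> lies in \<open>A\<close>, which the compact
    \<open>S\<close> generates over \<open>Y\<close>; so the chain condition for \<open>Y\<close>
    applies.\<close>
  have gen_J: "generates Y S (J n)" for n
    using inv_hull_least[of _ Y S] J_sub unfolding generates_def A_def by blast
  have "\<exists>n. \<forall>k. J k \<subseteq> J n"
    by (rule open_chain_stabilizes[where U = O' and K = S])
       (fact noeth J_between J_inv J_mono O_open O_one O_J S gen_J)+
  then obtain n1 where n1: "\<And>k. J k \<subseteq> J n1" by blast
  \<comment> \<open>\<open>J n1\<close> holds leading coefficients in degree n1 + 1, so generators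
    up to that degree are needed.\<close>
  define n2 where "n2 = Suc n1"
  have B_closed: "closedin T (B n)" for n
    using UA AB by (intro closedin_open_subgroup[OF subgroup_H H_closed betweenD(1,3)[OF B(1)] UW(1,3)]) blast
  obtain K' where K': "compactin T K'" "K' \<subseteq> N \<inter> B n2" "generates Y K' (N \<inter> B n2)"
    using noetherianD[OF noeth between_Int[OF N(1) B(1)] closedin_Int[OF N(2) B_closed]
        invariant_Int[OF N_Y B(2)] SB generates_mono[OF gen_B Int_lower2]] by blast
  have "generates (insert t Y) K' N"
    unfolding generates_def
  proof (intro allI impI, elim conjE)
    fix D assume D: "between D" "invariant (insert t Y) D" "K' \<subseteq> D"
    have D_Y: "invariant Y D" and D_t: "\<And>x. x \<in> D \<Longrightarrow> conj_by t x \<in> D"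
      "\<And>x. x \<in> D \<Longrightarrow> conj_by (inv t) x \<in> D"
      using D(2) by (auto simp: invariant_def)
    have base: "N \<inter> B n2 \<subseteq> D" using K'(3) D(1,3) D_Y by (auto simp: generates_def)
    \<comment> \<open>Cancellation of leading terms: the coefficient \<open>a\<close> of
      \<open>x\<close> in degree n + 2 already lies in \<open>J n\<close>, so it is also the leading
      coefficient of some \<open>y\<close> in \<open>N\<close> of degree n + 1. Dividing
      \<open>x\<close> by the conjugate of \<open>y\<close> by \<open>t\<close> leaves
      \<open>r\<close> in \<open>N\<close> of degree at most n + 1.\<close>
    have NBD: "N \<inter> B (n2 + k) \<subseteq> D" for k
    proof (induction k)
      case 0 then show ?case using base by simp
    next
      case (Suc k)
      define n where "n = n1 + k"
      have n: "n2 + k = Suc n" by (simp add: n2_def n_def)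
      show ?case
      proof
        fix x assume "x \<in> N \<inter> B (n2 + Suc k)"
        then have x: "x \<in> N" "x \<in> B (Suc (Suc n))" using n by auto
        then obtain a b where ab: "a \<in> A" "b \<in> B (Suc n)" "x = c (Suc (Suc n)) a \<otimes> b"
          unfolding B_Suc[of "Suc n"] by (auto simp: set_mult_def)
        have car: "a \<in> carrier G" "b \<in> carrier G" "x \<in> carrier G"
          using x ab betweenD(5)[OF A(1)] betweenD(5)[OF B(1)] betweenD(5)[OF N(1)] by auto
        have "c (Suc (Suc n)) a = x \<otimes> inv b" using ab(3) car c_carrier by (simp add: m_assoc)
        then have "c (Suc (Suc n)) a \<in> N <#> B (Suc n)"
          using x(1) betweenD(7)[OF B(1) ab(2)] by (auto simp: set_mult_def)
        then have "a \<in> J (Suc n)" using ab(1) by (simp add: J_def)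
        moreover have "J n1 \<subseteq> J n"
          by (rule lift_Suc_mono_le[of J, OF J_mono]) (simp add: n_def)
        ultimately have "a \<in> J n" using n1[of "Suc n"] by blast
        then obtain y b' where yb: "y \<in> N" "b' \<in> B n" "c (Suc n) a = y \<otimes> b'"
          by (auto simp: J_def set_mult_def)
        have car': "y \<in> carrier G" "b' \<in> carrier G"
          using yb betweenD(5)[OF B(1)] betweenD(5)[OF N(1)] by auto
        have "y = c (Suc n) a \<otimes> inv b'" using yb(3) car' by (simp add: m_assoc)
        then have "y \<in> B (Suc n)"
          using betweenD(6,7)[OF B(1)] tA[OF ab(1), of "Suc n"] B_mono1[of n] yb(2) by blast
        then have yD: "conj_by t y \<in> D" using Suc.IH yb(1) n D_t by auto
        define r where "r = conj_by t b' \<otimes> b"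
        have x_eq: "x = conj_by t y \<otimes> r"
          unfolding r_def using car car' t ab(3)
          by (simp add: c_Suc[of a "Suc n"] yb(3) conj_by_mult m_assoc)
        have rB: "r \<in> B (Suc n)"
          unfolding r_def using betweenD(6)[OF B(1) tB[OF yb(2)] ab(2)] .
        have "r \<in> carrier G" using rB betweenD(5)[OF B(1)] by blast
        then have "r = inv (conj_by t y) \<otimes> x" using x_eq car' t by simp
        then have "r \<in> N" using betweenD(6,7)[OF N(1)] N_t(1)[OF yb(1)] x(1) by blast
        then have "r \<in> D" using Suc.IH rB n by auto
        then show "x \<in> D" using x_eq yD betweenD(6)[OF D(1)] by blast
      qed
    qed
    have NBD': "N \<inter> B n \<subseteq> D" for n
      using NBD[of n] B_mono[of n "n2 + n"] by auto
    \<comment> \<open>The \<open>B n\<close> involve only nonnegative powers of \<open>t\<close>.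
      \<open>M\<close> collects the elements that some power of \<open>t\<close> carries into a
      \<open>B n\<close>, as one clears denominators of Laurent polynomials; it is stable under
      \<open>t\<close> and its inverse.\<close>
    define M where "M = {x \<in> H. \<exists>k n. c k x \<in> B n}"
    have M_up: "\<exists>n. c (k + j) x \<in> B n" if "x \<in> H" "c k x \<in> B n" for k j n x
    proof -
      have "c (k + j) x = c j (c k x)"
        using H_carrier[OF that(1)] t by (simp add: c_def conj_by_conj_by nat_pow_mult add.commute)
      then show ?thesis using cB[OF that(2)] by auto
    qed
    have "subgroup M G"
    proof (rule subgroupI)
      show "M \<subseteq> carrier G" using H_carrier by (auto simp: M_def)
      have "c 0 \<one> \<in> B 0" using c_0 betweenD(4)[OF B(1)] by simp
      then show "M \<noteq> {}" using betweenD(4)[OF between_H] by (auto simp: M_def)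
      show "inv x \<in> M" if "x \<in> M" for x
      proof -
        obtain k n where "x \<in> H" "c k x \<in> B n" using \<open>x \<in> M\<close> by (auto simp: M_def)
        then have "inv x \<in> H" "c k (inv x) \<in> B n"
          using betweenD(7)[OF between_H] betweenD(7)[OF B(1)] H_carrier by (auto simp: c_inv)
        then show ?thesis by (auto simp: M_def)
      qed
      show "x \<otimes> y \<in> M" if xy: "x \<in> M" "y \<in> M" for x y
      proof -
        obtain k n where x: "x \<in> H" "c k x \<in> B n" using xy by (auto simp: M_def)
        obtain l m where y: "y \<in> H" "c l y \<in> B m" using xy by (auto simp: M_def)
        obtain p q where pq: "c (k + l) x \<in> B p" "c (k + l) y \<in> B q"
          using M_up[OF x, of l] M_up[OF y, of k] by (auto simp: add.commute)
        then have "c (k + l) x \<in> B (max p q)" "c (k + l) y \<in> B (max p q)"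
          using B_mono[of p "max p q"] B_mono[of q "max p q"] by auto
        then have "c (k + l) (x \<otimes> y) \<in> B (max p q)"
          using betweenD(6)[OF B(1)] x(1) y(1) H_carrier by (simp add: c_mult)
        then show ?thesis using betweenD(6)[OF between_H x(1) y(1)] by (auto simp: M_def)
      qed
    qed
    moreover have M0: "x \<in> M" if "x \<in> A" for x
    proof -
      have "c 0 x \<in> B 0" using tA[OF that] .
      then show ?thesis using that betweenD(3)[OF A(1)] by (auto simp: M_def)
    qed
    ultimately have M: "between M" using betweenD(2)[OF A(1)] by (auto simp: between_def M_def)
    have "invariant (insert t Y) M"
    proof -
      have 1: "conj_by y x \<in> M" if "y \<in> carrier G" "x \<in> H" "conj_by y (c k x) \<in> B n" for y x k n
        using that conj_by_swap[OF B(1) that(1) tn that(2)] conj_by_H unfolding M_def c_def by blast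
      have 2: "conj_by t x \<in> M" if x: "x \<in> H" "c k x \<in> B n" for x k n
      proof -
        have "c k (conj_by t x) = conj_by t (c k x)"
          using c_Suc[of x k] c_Suc'[of x k] H_carrier x(1) by simp
        then have "c k (conj_by t x) \<in> B (Suc n)" using tB[OF x(2)] by simp
        then show ?thesis using conj_by_H[OF t x(1)] unfolding M_def by blast
      qed
      have 3: "conj_by (inv t) x \<in> M" if x: "x \<in> H" "c k x \<in> B n" for x k n
      proof -
        have "c (Suc k) (conj_by (inv t) x) = c k x"
          using c_Suc'[of "conj_by (inv t) x" k] H_carrier[OF x(1)] t by simp
        then have "c (Suc k) (conj_by (inv t) x) \<in> B n" using x(2) by simp
        then show ?thesis using conj_by_H[OF inv_closed[OF t] x(1)] unfolding M_def by blast
      qed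
      have "conj_by y x \<in> M \<and> conj_by (inv y) x \<in> M" if "y \<in> Y" "x \<in> M" for y x
      proof -
        obtain k n where x: "x \<in> H" "c k x \<in> B n" using \<open>x \<in> M\<close> by (auto simp: M_def)
        have y: "y \<in> carrier G" "inv y \<in> carrier G" using Y \<open>y \<in> Y\<close> by auto
        have "conj_by y (c k x) \<in> B n" "conj_by (inv y) (c k x) \<in> B n"
          using B(2)[of n] \<open>y \<in> Y\<close> x(2) by (auto simp: invariant_def)
        then show ?thesis using 1 x(1) y by blast
      qed
      moreover have "conj_by t x \<in> M \<and> conj_by (inv t) x \<in> M" if "x \<in> M" for x
        using that 2 3 unfolding M_def by blast
      ultimately show ?thesis by (auto simp: invariant_def)
    qed
    moreover have "K \<subseteq> M"
      using M0 inv_hull_superset[of S Y] by (auto simp: A_def S_def)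
    ultimately have NM: "N \<subseteq> M" using K(3) M by (auto simp: generates_def)
    \<comment> \<open>As \<open>D\<close> is stable under the inverse of \<open>t\<close>,
      membership may be tested after applying a power of \<open>t\<close>.\<close>
    have pull_back: "x \<in> D" if "x \<in> N" "c k x \<in> D" for x k
      using that
    proof (induction k)
      case 0 then show ?case using c_0 betweenD(5)[OF N(1)] by simp
    next
      case (Suc k)
      have x: "x \<in> carrier G" using betweenD(5)[OF N(1)] Suc.prems by blast
      have "conj_by (inv t) (c (Suc k) x) = c k x"
        using x t c_carrier by (simp add: c_Suc)
      then have "c k x \<in> D" using D_t(2)[OF Suc.prems(2)] by simp
      then show ?case using Suc by blast
    qed
    have cN: "c k x \<in> N" if "x \<in> N" for k x
    proof (induction k)
      case 0 then show ?case using that betweenD(5)[OF N(1)] by (simp add: c_0)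
    next
      case (Suc k) then show ?case using N_t(1) betweenD(5)[OF N(1) that] by (simp add: c_Suc)
    qed
    show "N \<subseteq> D"
    proof
      fix x assume x: "x \<in> N"
      then obtain k n where "c k x \<in> B n" using NM by (auto simp: M_def)
      then have "c k x \<in> D" using cN[OF x] NBD' by blast
      then show "x \<in> D" using pull_back x by blast
    qed
  qed
  then show "\<exists>K'. compactin T K' \<and> K' \<subseteq> N \<and> generates (insert t Y) K' N"
    using K'(1,2) by blast
qed

theorem noetherian_finite:
  assumes "finite Y" "Y \<subseteq> carrier G"
  shows "noetherian Y"
  using assms by (induction rule: finite_induct) (auto intro: noetherian_empty noetherian_insert)

end

section \<open>Compact generation of closed normal subgroups\<close>

lemma (in group) conj_by_generate_closed:
  assumes "F \<subseteq> carrier G" "B \<subseteq> carrier G"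
    and F: "\<forall>y\<in>F. \<forall>b\<in>B. conj_by y b \<in> B \<and> conj_by (inv y) b \<in> B"
    and "g \<in> generate G F" "b \<in> B"
  shows "conj_by g b \<in> B"
  using assms(4,5)
proof (induction arbitrary: b rule: generate.induct)
  case one
  then show ?case using assms(2) by auto
next
  case (incl h)
  then show ?case using F by blast
next
  case (inv h)
  then show ?case using F by blast
next
  case (eng h1 h2)
  have "h1 \<in> carrier G" "h2 \<in> carrier G" "b \<in> carrier G"
    using eng.hyps eng.prems assms(1,2) generate_in_carrier by blast+
  moreover have "conj_by h1 (conj_by h2 b) \<in> B" using eng by blast
  ultimately show ?case by (simp add: conj_by_conj_by)
qed

section \<open>Compact generation above the derived subgroup\<close>

context lc_group
begin

text \<open>Since L L is contained in F L, the products of the group generated by \<open>F\<close>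
  with \<open>L\<close> are stable under right multiplication by \<open>L\<close>, hence fill
  \<open>G\<close>. Up to a compact set, conjugation by \<open>G\<close> thus reduces to finitely
  many automorphisms.\<close>

lemma compactly_generated_cover:
  assumes "compactly_generated G T"
  obtains F L where "finite F" "F \<subseteq> carrier G" "compactin T L" "generate G L = carrier G"
    "\<forall>l\<in>L. inv l \<in> L" "\<forall>g\<in>carrier G. \<exists>f\<in>generate G F. \<exists>l\<in>L. g = f \<otimes> l"
proof -
  obtain K where K: "compactin T K" "generate G K = carrier G"
    using assms by (auto simp: compactly_generated_def)
  have Kc: "K \<subseteq> carrier G" using compactin_subset[OF K(1)] .
  obtain U W where UW: "openin T U" "compactin T W" "\<one> \<in> U" "U \<subseteq> W"
    "\<forall>u\<in>U. inv u \<in> U" "\<forall>w\<in>W. inv w \<in> W"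
    by (rule compact_nbhd)
  define L where "L = K \<union> m_inv G ` K \<union> W"
  have L: "compactin T L" unfolding L_def by (intro compactin_Un compactin_inv K(1) UW(2))
  have Lc: "L \<subseteq> carrier G" using compactin_subset[OF L] .
  have L_inv: "\<forall>l\<in>L. inv l \<in> L" using UW(6) Kc by (auto simp: L_def)
  have L_one: "\<one> \<in> L" using UW(3,4) by (auto simp: L_def)
  have "generate G K \<subseteq> generate G L" by (rule mono_generate) (auto simp: L_def)
  then have L_gen: "generate G L = carrier G"
    using K(2) generate_incl[OF Lc] by auto
  have UL: "U \<inter> carrier G \<subseteq> L" using UW(4) by (auto simp: L_def)
  obtain F where F: "finite F" "F \<subseteq> carrier G" "L <#> L \<subseteq> F <#> L"
    by (rule finite_translates[OF subgroup_self L Lc UW(1,3) UL])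
  define R where "R = generate G F <#> L"
  have gF: "generate G F \<subseteq> carrier G" by (rule generate_incl[OF F(2)])
  have RL: "r \<otimes> l \<in> R" if r: "r \<in> R" and l: "l \<in> L" for r l
  proof -
    obtain g k where g: "g \<in> generate G F" "k \<in> L" "r = g \<otimes> k" using r by (auto simp: R_def set_mult_def)
    have "k \<otimes> l \<in> F <#> L" using F(3) g(2) l by (auto simp: set_mult_def)
    then obtain f k' where f: "f \<in> F" "k' \<in> L" "k \<otimes> l = f \<otimes> k'" by (auto simp: set_mult_def)
    have car: "g \<in> carrier G" "k \<in> carrier G" "l \<in> carrier G" "f \<in> carrier G" "k' \<in> carrier G"
      using g l f gF F(2) Lc by auto
    have "r \<otimes> l = g \<otimes> (k \<otimes> l)" using car g(3) by (simp add: m_assoc)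
    then have "r \<otimes> l = (g \<otimes> f) \<otimes> k'" using car f(3) by (simp add: m_assoc)
    moreover have "g \<otimes> f \<in> generate G F" using generate.eng[OF g(1) generate.incl[OF f(1)]] .
    ultimately show ?thesis using f(2) by (auto simp: R_def set_mult_def)
  qed
  have Rc: "R \<subseteq> carrier G" using gF Lc by (auto simp: R_def set_mult_def)
  have RgL: "r \<otimes> x \<in> R" if "x \<in> generate G L" "r \<in> R" for r x
    using that
  proof (induction arbitrary: r rule: generate.induct)
    case one
    then show ?case using Rc by auto
  next
    case (incl h)
    then show ?case using RL by blast
  next
    case (inv h)
    then show ?case using RL L_inv by blast
  next
    case (eng h1 h2)
    have "h1 \<in> carrier G" "h2 \<in> carrier G" "r \<in> carrier G"
      using eng.hyps eng.prems Lc Rc generate_in_carrier by blast+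
    moreover have "(r \<otimes> h1) \<otimes> h2 \<in> R" using eng by blast
    ultimately show ?case by (simp add: m_assoc)
  qed
  have one_R: "\<one> \<in> R"
  proof -
    have "\<one> = \<one> \<otimes> \<one>" by simp
    then show ?thesis using L_one generate.one unfolding R_def set_mult_def by blast
  qed
  have "\<exists>f\<in>generate G F. \<exists>l\<in>L. g = f \<otimes> l" if "g \<in> carrier G" for g
  proof -
    have "\<one> \<otimes> g \<in> R" using RgL[OF _ one_R] that L_gen by blast
    then show ?thesis using that by (auto simp: R_def set_mult_def)
  qed
  then show ?thesis using that[OF F(1,2) L L_gen L_inv] by blast
qed

lemma normal_of_derived_subset:
  assumes "subgroup A G" "derived G (carrier G) \<subseteq> A"
  shows "A \<lhd> G"
proof -
  have "conj_by g a \<in> A" if "g \<in> carrier G" "a \<in> A" for g a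
  proof -
    have a: "a \<in> carrier G" using subgroup.mem_carrier[OF assms(1) that(2)] .
    have "comm g a \<otimes> a \<in> A"
      using comm_in_derived[OF that(1) a] assms(2) subgroup.m_closed[OF assms(1) _ that(2)] by blast
    then show ?thesis using that(1) a by (simp add: word_simps)
  qed
  then show ?thesis using assms(1) by (simp add: normal_iff_conj_by)
qed

lemma derived_normal: "derived G (carrier G) \<lhd> G"
  by (rule normal_of_derived_subset) (auto intro: derived_is_subgroup)

text \<open>Modulo the derived subgroup the case without automorphisms applies. The derived subgroup
  lies in any normal subgroup containing the commutators of elements of \<open>L\<close>, as
  \<open>L\<close> generates \<open>G\<close>. Conjugating both compact sets by \<open>L\<close>
  replaces normality by invariance under \<open>F\<close>.\<close>

lemma compactly_generated_above_derived:
  assumes A: "subgroup A G" "closedin T A" "derived G (carrier G) \<subseteq> A"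
    and F: "F \<subseteq> carrier G" and L: "compactin T L" "generate G L = carrier G"
    and cover: "\<forall>g\<in>carrier G. \<exists>f\<in>generate G F. \<exists>l\<in>L. g = f \<otimes> l"
  obtains C where "compactin T C" "C \<subseteq> A"
    "\<forall>B. subgroup B G \<and> (\<forall>y\<in>F. \<forall>b\<in>B. conj_by y b \<in> B \<and> conj_by (inv y) b \<in> B) \<and> C \<subseteq> B
      \<longrightarrow> A \<subseteq> B"
proof -
  let ?D = "derived G (carrier G)"
  have Lc: "L \<subseteq> carrier G" using compactin_subset[OF L(1)] .
  have Anorm: "A \<lhd> G" by (rule normal_of_derived_subset[OF A(1,3)])
  have Dc: "?D \<subseteq> carrier G" using derived_in_carrier by blast
  \<comment> \<open>The derived subgroup need not be closed, which is why \<open>Z\<close> may be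
    non-closed in a section.\<close>
  interpret D: lc_section G T "carrier G" ?D
  proof (intro lc_section.intro lc_section_axioms.intro)
    show "lc_group G T" by (rule lc_group_axioms)
    show "carrier G \<lhd> G" by (rule normal_self)
    show "closedin T (carrier G)" using closedin_topspace[of T] by simp
    show "?D \<lhd> G" by (rule derived_normal)
    show "?D \<subseteq> carrier G" by (rule Dc)
    show "carrier G \<union> ?D \<subseteq> centralizer_mod ?D (carrier G)"
      using Dc comm_in_derived by (auto simp: centralizer_mod_def)
  qed
  have "D.between A" using A subgroup.subset[OF A(1)] by (simp add: D.between_def)
  moreover have "D.invariant {} A" by (simp add: D.invariant_def)
  moreover have "D.generates {} L A"
    unfolding D.generates_def
  proof (intro allI impI, elim conjE)
    fix B assume "D.between B" "L \<subseteq> B"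
    then have "generate G L \<subseteq> B" by (intro generate_subgroup_incl) (auto simp: D.between_def)
    then show "A \<subseteq> B" using L(2) subgroup.subset[OF A(1)] by blast
  qed
  ultimately obtain C1 where C1: "compactin T C1" "C1 \<subseteq> A" "D.generates {} C1 A"
    using D.noetherianD[OF D.noetherian_empty _ A(2) _ L(1) Lc] by blast
  define C2 where "C2 = (\<Union>k\<in>L. \<Union>l\<in>L. {comm k l})"
  have "comm k l \<in> A" if "k \<in> L" "l \<in> L" for k l
    using comm_in_derived[of k "carrier G" l] that Lc A(3) by blast
  then have C2: "compactin T C2" "C2 \<subseteq> A"
    unfolding C2_def using compactin_comm[OF L(1) L(1)] by auto
  define C where "C = (\<Union>k\<in>L. \<Union>c\<in>C1 \<union> C2. {conj_by k c})"
  have "compactin T C" unfolding C_def by (intro compactin_conj compactin_Un L(1) C1(1) C2(1))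
  moreover have "C \<subseteq> A"
    using C1(2) C2(2) Lc Anorm unfolding C_def normal_iff_conj_by by blast
  moreover have "A \<subseteq> B"
    if B: "subgroup B G" "\<forall>y\<in>F. \<forall>b\<in>B. conj_by y b \<in> B \<and> conj_by (inv y) b \<in> B" "C \<subseteq> B" for B
  proof -
    interpret B: subgroup B G by (rule B(1))
    \<comment> \<open>\<open>M\<close> is the normal core of \<open>B\<close>.\<close>
    define M where "M = {x \<in> carrier G. \<forall>g\<in>carrier G. conj_by g x \<in> B}"
    have "subgroup M G"
    proof (rule subgroupI)
      show "M \<subseteq> carrier G" by (auto simp: M_def)
      have "\<one> \<in> M" by (auto simp: M_def)
      then show "M \<noteq> {}" by blast
      show "inv x \<in> M" if "x \<in> M" for x using that by (auto simp: M_def conj_by_inv)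
      show "x \<otimes> y \<in> M" if "x \<in> M" "y \<in> M" for x y using that by (auto simp: M_def conj_by_mult)
    qed
    moreover have "conj_by g x \<in> M" if "g \<in> carrier G" "x \<in> M" for g x
      using that by (auto simp: M_def conj_by_conj_by)
    ultimately have M: "M \<lhd> G" "subgroup M G" by (simp_all add: normal_iff_conj_by)
    have CM: "C1 \<union> C2 \<subseteq> M"
    proof
      fix x assume x: "x \<in> C1 \<union> C2"
      then have xc: "x \<in> carrier G" using C1(2) C2(2) subgroup.subset[OF A(1)] by blast
      have "conj_by g x \<in> B" if g: "g \<in> carrier G" for g
      proof -
        obtain f l where fl: "f \<in> generate G F" "l \<in> L" "g = f \<otimes> l" using cover g by blast
        have car: "f \<in> carrier G" "l \<in> carrier G"
          using fl generate_in_carrier[OF F] Lc by auto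
        have "conj_by l x \<in> B" using B(3) x fl(2) by (auto simp: C_def)
        then have "conj_by f (conj_by l x) \<in> B"
          using conj_by_generate_closed[OF F B.subset B(2) fl(1)] by blast
        then show ?thesis using car xc fl(3) by (simp add: conj_by_conj_by)
      qed
      then show "x \<in> M" using xc by (simp add: M_def)
    qed
    then have "L \<subseteq> centralizer_mod M L" 
      using Lc unfolding centralizer_mod_def C2_def by blast
    then have "carrier G \<subseteq> centralizer_mod M (carrier G)"
      using centralizer_mod_generate[OF M(1) Lc] by (simp add: L(2))
    then have "?D \<subseteq> M"
      using derived_subset_iff[OF M(2)] by (auto simp: centralizer_mod_def)
    then have "D.between M" using M(2) subgroup.subset[OF M(2)] by (simp add: D.between_def)
    then have "A \<subseteq> M"
      using C1(3) CM unfolding D.generates_def D.invariant_def by blast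
    then show "A \<subseteq> B"
    proof -
      have "x \<in> B" if "x \<in> M" for x
      proof -
        have "conj_by \<one> x \<in> B" "x \<in> carrier G"
          using that unfolding M_def by blast+
        then show ?thesis by simp
      qed
      then show ?thesis using \<open>A \<subseteq> M\<close> by blast
    qed
  qed
  ultimately show ?thesis using that[of C] by blast
qed

lemma invariant_Int_normal:
  assumes "M \<lhd> G" "F \<subseteq> carrier G" "N \<lhd> G"
  shows "\<forall>y\<in>F. \<forall>b\<in>M \<inter> N. conj_by y b \<in> M \<inter> N \<and> conj_by (inv y) b \<in> M \<inter> N"
  using assms by (auto simp: normal_iff_conj_by)

text \<open>Normal compact generation of \<open>N\<close> is established first for \<open>N \<inter> A\<close>, where \<open>A\<close> is the closure of
  the derived subgroup, and then for \<open>N\<close> modulo \<open>N \<inter> A\<close>, which is central in \<open>G\<close> modulo \<open>N \<inter> A\<close> and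
  hence lies in the abelian section \<open>H / (N \<inter> A)\<close> with \<open>H\<close> the closure of \<open>A N\<close>.\<close>

lemma closed_normal_compactly_generated:
  assumes G: "compactly_generated G T" "metabelian G" and N: "N \<lhd> G" "closedin T N"
  obtains C where "compactin T C" "C \<subseteq> N" "\<forall>M. M \<lhd> G \<and> C \<subseteq> M \<longrightarrow> N \<subseteq> M"
proof -
  let ?D = "derived G (carrier G)"
  obtain F L where F: "finite F" "F \<subseteq> carrier G" and L: "compactin T L" "generate G L = carrier G"
    "\<forall>l\<in>L. inv l \<in> L" and cover: "\<forall>g\<in>carrier G. \<exists>f\<in>generate G F. \<exists>l\<in>L. g = f \<otimes> l"
    by (rule compactly_generated_cover[OF G(1)])
  have Nsub: "subgroup N G" and Nconj: "\<And>g x. g \<in> carrier G \<Longrightarrow> x \<in> N \<Longrightarrow> conj_by g x \<in> N"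
    using N(1) by (auto simp: normal_iff_conj_by)
  have Dc: "?D \<subseteq> carrier G" using derived_in_carrier by blast
  define A where "A = T closure_of ?D"
  have A: "A \<lhd> G" "closedin T A" "?D \<subseteq> A"
    unfolding A_def using normal_closure_of[OF derived_normal] closure_of_subset[of ?D T] Dc by auto
  have Asub: "subgroup A G" using A(1) normal_imp_subgroup by blast
  have Ac: "A \<subseteq> carrier G" using subgroup.subset[OF Asub] .
  have one: "{\<one>} \<lhd> G" "closedin T {\<one>}"
    using one_is_normal closedin_Hausdorff_sing_eq[OF Hausdorff] by auto
  \<comment> \<open>Since the trivial subgroup is closed, commutativity of the derived subgroup
    extends to its closure \<open>A\<close>.\<close>
  have "?D \<subseteq> centralizer_mod {\<one>} ?D"
  proof
    fix x assume x: "x \<in> ?D"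
    have "comm x y = \<one>" if "y \<in> ?D" for y
    proof -
      have car: "x \<in> carrier G" "y \<in> carrier G" using x that Dc by auto
      have "x \<otimes> y = y \<otimes> x" using G(2) x that by (auto simp: metabelian_def)
      then show ?thesis using car by (simp add: comm_def m_assoc)
    qed
    then show "x \<in> centralizer_mod {\<one>} ?D" using x Dc by (auto simp: centralizer_mod_def)
  qed
  then have A_ab: "A \<subseteq> centralizer_mod {\<one>} A"
    unfolding A_def by (rule centralizer_mod_closure_of[OF one Dc])
  interpret A: lc_section G T A "{\<one>}"
  proof (intro lc_section.intro lc_section_axioms.intro)
    show "lc_group G T" by (rule lc_group_axioms)
    show "A \<lhd> G" "closedin T A" "{\<one>} \<lhd> G" using A one by auto
    show "{\<one>} \<subseteq> A" using subgroup.one_closed[OF Asub] by auto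
    show "A \<union> ?D \<subseteq> centralizer_mod {\<one>} A" using A_ab A(3) by auto
  qed
  obtain C0 where C0: "compactin T C0" "C0 \<subseteq> A"
    "\<forall>B. subgroup B G \<and> (\<forall>y\<in>F. \<forall>b\<in>B. conj_by y b \<in> B \<and> conj_by (inv y) b \<in> B) \<and> C0 \<subseteq> B
      \<longrightarrow> A \<subseteq> B"
    by (rule compactly_generated_above_derived[OF Asub A(2,3) F(2) L(1,2) cover])
  define Z where "Z = N \<inter> A"
  have Zsub: "subgroup Z G" unfolding Z_def by (rule subgroups_Inter_pair[OF Nsub Asub])
  have Z: "Z \<lhd> G" "closedin T Z" unfolding Z_def
    using Zsub N A Nconj by (auto simp: normal_iff_conj_by Z_def intro: closedin_Int)
  have "A.between Z" 
    using Zsub subgroup.one_closed[OF Zsub] by (auto simp: A.between_def Z_def)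
  moreover have "A.invariant F Z"
    unfolding A.invariant_def Z_def by (rule invariant_Int_normal[OF N(1) F(2) A(1)])
  moreover have "A.generates F C0 Z"
    unfolding A.generates_def A.between_def A.invariant_def using C0(3) by (auto simp: Z_def)
  ultimately obtain C1 where C1: "compactin T C1" "C1 \<subseteq> Z" "A.generates F C1 Z"
    using A.noetherianD[OF A.noetherian_finite[OF F] _ Z(2) _ C0(1,2)] by blast
  \<comment> \<open>\<open>A \<union> N\<close> is commutative modulo \<open>Z\<close>. This passes
    to the generated subgroup \<open>E\<close> and to its closure \<open>H\<close>, which is taken
    because a section needs a closed \<open>H\<close>.\<close>
  define E where "E = generate G (A \<union> N)"
  have ANc: "A \<union> N \<subseteq> carrier G" using Ac subgroup.subset[OF Nsub] by auto
  have E: "E \<lhd> G"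
    unfolding E_def
  proof (rule normal_generateI[OF ANc])
    fix h g assume "h \<in> A \<union> N" "g \<in> carrier G"
    then show "g \<otimes> h \<otimes> inv g \<in> A \<union> N" using A(1) N(1) by (auto simp: normal_inv_iff)
  qed
  have Esub: "subgroup E G" using E normal_imp_subgroup by blast
  \<comment> \<open>The commutator lies in \<open>N\<close> by normality, and in \<open>A\<close>
    because \<open>A\<close> contains the derived subgroup.\<close>
  have commZ: "comm x y \<in> Z \<and> comm y x \<in> Z" if "x \<in> carrier G" "y \<in> N" for x y
  proof -
    have y: "y \<in> carrier G" using that ANc by auto
    have "conj_by x y \<otimes> inv y \<in> N"
      using Nconj[OF that] subgroup.m_closed[OF Nsub] subgroup.m_inv_closed[OF Nsub that(2)] by blast
    then have "comm x y \<in> N" using that(1) y by (simp add: word_simps)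
    then have "comm x y \<in> Z" using comm_in_derived[OF that(1) y] A(3) by (auto simp: Z_def)
    then show ?thesis using comm_inv[OF that(1) y] subgroup.m_inv_closed[OF Zsub] by metis
  qed
  have "comm x y \<in> Z" if "x \<in> A" "y \<in> A" for x y
    using that A_ab subgroup.one_closed[OF Zsub] by (auto simp: centralizer_mod_def)
  then have "A \<union> N \<subseteq> centralizer_mod Z (A \<union> N)"
    using commZ ANc by (auto simp: centralizer_mod_def)
  then have "E \<subseteq> centralizer_mod Z E"
    unfolding E_def by (rule centralizer_mod_generate[OF Z(1) ANc])
  moreover define H where "H = T closure_of E"
  ultimately have H_ab: "H \<subseteq> centralizer_mod Z H"
    using centralizer_mod_closure_of[OF Z subgroup.subset[OF Esub]] by simp
  have AN_E: "A \<union> N \<subseteq> E" unfolding E_def by (auto intro: generate.incl)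
  have H: "H \<lhd> G" "closedin T H" "A \<union> N \<subseteq> H"
    unfolding H_def using normal_closure_of[OF E] closure_of_subset[of E T] subgroup.subset[OF Esub] AN_E
    by auto
  have Hsub: "subgroup H G" using H(1) normal_imp_subgroup by blast
  interpret H: lc_section G T H Z
  proof (intro lc_section.intro lc_section_axioms.intro)
    show "lc_group G T" by (rule lc_group_axioms)
    show "H \<lhd> G" "closedin T H" "Z \<lhd> G" using H Z by auto
    show "Z \<subseteq> H" using H(3) by (auto simp: Z_def)
    show "H \<union> ?D \<subseteq> centralizer_mod Z H" using H_ab A(3) H(3) by auto
  qed
  have DH: "?D \<subseteq> H" using A(3) H(3) by blast
  obtain C0' where C0': "compactin T C0'" "C0' \<subseteq> H"
    "\<forall>B. subgroup B G \<and> (\<forall>y\<in>F. \<forall>b\<in>B. conj_by y b \<in> B \<and> conj_by (inv y) b \<in> B) \<and> C0' \<subseteq> B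
      \<longrightarrow> H \<subseteq> B"
    by (rule compactly_generated_above_derived[OF Hsub H(2) DH F(2) L(1,2) cover])
  have "H.between N" 
    unfolding H.between_def using Nsub H(3) by (auto simp: Z_def)
  moreover have "H.invariant F N"
    using invariant_Int_normal[OF N(1) F(2) N(1)] by (simp add: H.invariant_def)
  moreover have "H.generates F C0' N"
    unfolding H.generates_def H.between_def H.invariant_def using C0'(3) H(3) by auto
  ultimately obtain C2 where C2: "compactin T C2" "C2 \<subseteq> N" "H.generates F C2 N"
    using H.noetherianD[OF H.noetherian_finite[OF F] _ N(2) _ C0'(1,2)] by blast
  \<comment> \<open>The order matters: \<open>C1\<close> first puts \<open>Z\<close> into
    \<open>M\<close>, and only then is \<open>M \<inter> H\<close> a subgroup between
    \<open>Z\<close> and \<open>H\<close> to which \<open>C2\<close> applies.\<close>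
  have "N \<subseteq> M" if M: "M \<lhd> G" "C1 \<union> C2 \<subseteq> M" for M
  proof -
    have Msub: "subgroup M G" using M(1) normal_imp_subgroup by blast
    have "A.between (M \<inter> A)"
      using subgroups_Inter_pair[OF Msub Asub] subgroup.one_closed[OF Msub] subgroup.one_closed[OF Asub]
      by (simp add: A.between_def)
    moreover have "A.invariant F (M \<inter> A)"
      unfolding A.invariant_def by (rule invariant_Int_normal[OF M(1) F(2) A(1)])
    moreover have "C1 \<subseteq> M \<inter> A" using M(2) C1(2) by (auto simp: Z_def)
    ultimately have ZM: "Z \<subseteq> M \<inter> A"
      using C1(3) unfolding A.generates_def by blast
    have "H.between (M \<inter> H)"
      using subgroups_Inter_pair[OF Msub Hsub] ZM H(3) by (auto simp: H.between_def)
    moreover have "H.invariant F (M \<inter> H)"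
      unfolding H.invariant_def by (rule invariant_Int_normal[OF M(1) F(2) H(1)])
    moreover have "C2 \<subseteq> M \<inter> H" using M(2) C2(2) H(3) by auto
    ultimately show ?thesis
      using C2(3) unfolding H.generates_def by blast
  qed
  moreover have "compactin T (C1 \<union> C2)" using C1(1) C2(1) by (rule compactin_Un)
  moreover have "C1 \<union> C2 \<subseteq> N" using C1(2) C2(2) by (auto simp: Z_def)
  ultimately show ?thesis using that[of "C1 \<union> C2"] by blast
qed

section \<open>Cocompactness along an ascending chain\<close>

lemma normal_UN_chain:
  assumes "\<And>n::nat. N n \<lhd> G" "\<And>n. N n \<subseteq> N (Suc n)"
  shows "(\<Union>n. N n) \<lhd> G"
proof -
  have mono: "N k \<subseteq> N n" if "k \<le> n" for k n
    using that assms(2) by (rule lift_Suc_mono_le[rotated])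
  have sub: "subgroup (N n) G" for n using assms(1) normal_imp_subgroup by blast
  have "subgroup (\<Union>n. N n) G"
  proof (rule subgroupI)
    show "(\<Union>n. N n) \<subseteq> carrier G" using subgroup.subset[OF sub] by blast
    show "(\<Union>n. N n) \<noteq> {}" using subgroup.one_closed[OF sub] by blast
    show "inv x \<in> (\<Union>n. N n)" if "x \<in> (\<Union>n. N n)" for x
      using that subgroup.m_inv_closed[OF sub] by blast
    show "x \<otimes> y \<in> (\<Union>n. N n)" if xy: "x \<in> (\<Union>n. N n)" "y \<in> (\<Union>n. N n)" for x y
    proof -
      obtain k l where "x \<in> N k" "y \<in> N l" using xy by blast
      then have "x \<in> N (max k l)" "y \<in> N (max k l)"
        using mono[of k "max k l"] mono[of l "max k l"] by auto
      then show ?thesis using subgroup.m_closed[OF sub] by blast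
    qed
  qed
  then show ?thesis using assms(1) by (auto simp: normal_iff_conj_by)
qed

theorem eventually_cocompact:
  assumes G: "compactly_generated G T" "metabelian G"
    and N: "\<And>n::nat. N n \<lhd> G" "\<And>n. N n \<subseteq> N (Suc n)"
  shows "\<exists>n0. \<forall>n\<ge>n0. cocompact_in G T (N n) (T closure_of (\<Union>n. N n))"
proof -
  have mono: "N k \<subseteq> N n" if "k \<le> n" for k n
    using that N(2) by (rule lift_Suc_mono_le[rotated])
  have Nsub: "subgroup (N n) G" for n using N(1) normal_imp_subgroup by blast
  have Nconj: "conj_by g x \<in> N n" if "g \<in> carrier G" "x \<in> N n" for g x n
    using N(1)[of n] that by (simp add: normal_iff_conj_by)
  define M where "M = T closure_of (\<Union>n. N n)"
  have M: "M \<lhd> G" "closedin T M"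
    unfolding M_def using normal_closure_of[OF normal_UN_chain[of N, OF N]] by auto
  have Msub: "subgroup M G" using M(1) normal_imp_subgroup by blast
  interpret M: subgroup M G by (rule Msub)
  have NM: "N n \<subseteq> M" for n
    using closure_of_subset[of "\<Union>n. N n" T] subgroup.subset[OF Nsub] by (auto simp: M_def)
  obtain F L where F: "finite F" "F \<subseteq> carrier G" and L: "compactin T L" "generate G L = carrier G"
    "\<forall>l\<in>L. inv l \<in> L" and cover: "\<forall>g\<in>carrier G. \<exists>f\<in>generate G F. \<exists>l\<in>L. g = f \<otimes> l"
    by (rule compactly_generated_cover[OF G(1)])
  have Lc: "L \<subseteq> carrier G" using compactin_subset[OF L(1)] .
  obtain C where C: "compactin T C" "C \<subseteq> M" "\<forall>B. B \<lhd> G \<and> C \<subseteq> B \<longrightarrow> M \<subseteq> B"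
    by (rule closed_normal_compactly_generated[OF G M])
  obtain U W where UW: "openin T U" "compactin T W" "\<one> \<in> U" "U \<subseteq> W"
    "\<forall>u\<in>U. inv u \<in> U" "\<forall>w\<in>W. inv w \<in> W"
    by (rule compact_nbhd)
  have Uc: "U \<subseteq> carrier G" using openin_subset[OF UW(1)] by simp
  define S where "S = C \<union> m_inv G ` C \<union> (W \<inter> M)"
  have S: "compactin T S"
    unfolding S_def by (intro compactin_Un compactin_inv compact_Int_closedin C(1) UW(2) M(2))
  have SM: "S \<subseteq> M" using C(2) by (auto simp: S_def)
  have S_inv: "inv s \<in> S" if "s \<in> S" for s
    using that UW(6) C(2) by (auto simp: S_def)
  have S_one: "\<one> \<in> S" using UW(3,4) by (auto simp: S_def)
  \<comment> \<open>These elements must lie in N_n S for it to be closed under products and under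
    conjugation by \<open>L\<close>. Being compact, the set is absorbed at a finite stage.\<close>
  define P where "P = (S <#> S) \<union> (\<Union>l\<in>L. \<Union>s\<in>S. {conj_by l s})"
  have P: "compactin T P"
    unfolding P_def by (intro compactin_Un compactin_set_mult compactin_conj S L(1))
  have PM: "P \<subseteq> M"
    using SM M(1) Lc by (auto simp: P_def set_mult_def normal_iff_conj_by)
  \<comment> \<open>By density the neighbourhood x U of a point x of \<open>M\<close> meets some
    \<open>N n\<close>; symmetry of \<open>U\<close> then puts x into N n U.\<close>
  have "P \<subseteq> (\<Union>n. N n <#> U)"
  proof
    fix x assume "x \<in> P"
    then have x: "x \<in> T closure_of (\<Union>n. N n)" "x \<in> carrier G" using PM M.subset by (auto simp: M_def)
    have "x = x \<otimes> \<one>" using x(2) by simp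
    then have xU: "x \<in> {x} <#> U" using UW(3) unfolding set_mult_def by blast
    have "openin T ({x} <#> U)" using x(2) by (intro openin_set_mult UW(1)) auto
    then obtain y where y: "y \<in> (\<Union>n. N n)" "y \<in> {x} <#> U"
      using x(1) xU unfolding in_closure_of by blast
    then obtain n u where u: "y \<in> N n" "u \<in> U" "y = x \<otimes> u" by (auto simp: set_mult_def)
    have "x = y \<otimes> inv u" using u Uc x(2) by (auto simp: m_assoc)
    then show "x \<in> (\<Union>n. N n <#> U)" using u UW(5) by (auto simp: set_mult_def)
  qed
  moreover have "openin T (N n <#> U)" for n
    by (rule openin_set_mult[OF UW(1) subgroup.subset[OF Nsub]])
  moreover have "N n <#> U \<subseteq> N (Suc n) <#> U" for n
    by (rule mono_set_mult[OF N(2) subset_refl])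
  ultimately obtain n0 where n0: "P \<subseteq> N n0 <#> U"
    using compactin_subset_chain[OF P, of "\<lambda>n. N n <#> U"] by blast
  define Q where "Q = N n0 <#> S"
  interpret N0: subgroup "N n0" G by (rule Nsub)
  have QI: "y \<otimes> s \<in> Q" if "y \<in> N n0" "s \<in> S" for y s using that by (auto simp: Q_def set_mult_def)
  have QE: "\<exists>y s. y \<in> N n0 \<and> s \<in> S \<and> x = y \<otimes> s \<and> y \<in> carrier G \<and> s \<in> carrier G" if "x \<in> Q" for x
    using that SM N0.subset M.subset unfolding Q_def set_mult_def by blast
  \<comment> \<open>The factor from \<open>U\<close> lies in \<open>M\<close> too, hence in
    \<open>W \<inter> M\<close>, which is part of \<open>S\<close>.\<close>
  have PQ: "x \<in> Q" if "x \<in> P" for x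
  proof -
    obtain y u where yu: "y \<in> N n0" "u \<in> U" "x = y \<otimes> u" using n0 \<open>x \<in> P\<close> by (auto simp: set_mult_def)
    have "inv y \<otimes> x \<in> M" using yu(1) NM PM \<open>x \<in> P\<close> by blast
    then have "u \<in> M" using yu Uc by (auto simp: subset_iff)
    then show ?thesis using yu UW(4) QI[of y u] by (auto simp: S_def)
  qed
  have NQ: "y \<otimes> x \<in> Q" if x: "y \<in> N n0" "x \<in> Q" for y x
  proof -
    obtain z s where z: "z \<in> N n0" "s \<in> S" "x = z \<otimes> s" "z \<in> carrier G" "s \<in> carrier G"
      using QE x(2) by blast
    have "y \<otimes> x = (y \<otimes> z) \<otimes> s" using z x(1) by (simp add: m_assoc)
    then show ?thesis using QI[of "y \<otimes> z" s] z(1,2) x(1) by simp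
  qed
  have "subgroup Q G"
  proof (rule subgroupI)
    show "Q \<subseteq> carrier G" using QE by auto
    show "Q \<noteq> {}" using QI S_one N0.one_closed by blast
  next
    fix x assume "x \<in> Q"
    then obtain y s where y: "y \<in> N n0" "s \<in> S" "x = y \<otimes> s" "y \<in> carrier G" "s \<in> carrier G"
      using QE by blast
    have "inv x = conj_by (inv s) (inv y) \<otimes> inv s" using y by (simp add: word_simps)
    then show "inv x \<in> Q"
      using QI[OF Nconj[of "inv s" "inv y"] S_inv[OF y(2)]] y by simp
  next
    fix x x' assume "x \<in> Q" "x' \<in> Q"
    then obtain y s y' s' where y: "y \<in> N n0" "s \<in> S" "x = y \<otimes> s" "y \<in> carrier G" "s \<in> carrier G"
      and y': "y' \<in> N n0" "s' \<in> S" "x' = y' \<otimes> s'" "y' \<in> carrier G" "s' \<in> carrier G"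
      using QE by metis
    have "x \<otimes> x' = (y \<otimes> conj_by s y') \<otimes> (s \<otimes> s')" using y y' by (simp add: word_simps)
    moreover have "s \<otimes> s' \<in> Q" using y(2) y'(2) by (intro PQ) (auto simp: P_def set_mult_def)
    moreover have "y \<otimes> conj_by s y' \<in> N n0" using y y' Nconj by simp
    ultimately show "x \<otimes> x' \<in> Q" using NQ by simp
  qed
  moreover have "conj_by g x \<in> Q" if "g \<in> carrier G" "x \<in> Q" for g x
  proof (rule conj_by_generate_closed[OF Lc])
    show "Q \<subseteq> carrier G" using QE by auto
    have "conj_by l x \<in> Q" if "l \<in> L" "x \<in> Q" for l x
    proof -
      obtain y s where y: "y \<in> N n0" "s \<in> S" "x = y \<otimes> s" "y \<in> carrier G" "s \<in> carrier G"
        using QE \<open>x \<in> Q\<close> by blast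
      have l: "l \<in> carrier G" using \<open>l \<in> L\<close> Lc by blast
      have "conj_by l s \<in> Q" using y(2) \<open>l \<in> L\<close> by (intro PQ) (auto simp: P_def)
      then have "conj_by l y \<otimes> conj_by l s \<in> Q" using NQ Nconj[OF l y(1)] by blast
      then show ?thesis using y l by (simp add: conj_by_mult)
    qed
    then show "\<forall>l\<in>L. \<forall>x\<in>Q. conj_by l x \<in> Q \<and> conj_by (inv l) x \<in> Q" using L(3) by blast
    show "g \<in> generate G L" "x \<in> Q" using that L(2) by auto
  qed
  ultimately have Q: "Q \<lhd> G" by (simp add: normal_iff_conj_by)
  have "C \<subseteq> Q"
  proof
    fix x assume x: "x \<in> C"
    then have "\<one> \<otimes> x \<in> Q" by (intro QI) (auto simp: S_def)
    then show "x \<in> Q" using x C(2) M.subset by auto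
  qed
  then have MQ: "M \<subseteq> Q" using C(3) Q by blast
  \<comment> \<open>One \<open>S\<close> serves for all n \<ge> n0. As \<open>cocompact_in\<close>
    puts the compact factor first, y s is rewritten as s (s^-1 y s).\<close>
  have "cocompact_in G T (N n) M" if "n0 \<le> n" for n
    unfolding cocompact_in_def
  proof (intro exI conjI)
    show "compactin T S" "S \<subseteq> M" by (rule S, rule SM)
    have "x \<in> S <#> N n" if "x \<in> M" for x
    proof -
      obtain y s where y: "y \<in> N n0" "s \<in> S" "x = y \<otimes> s" "y \<in> carrier G" "s \<in> carrier G"
        using QE MQ \<open>x \<in> M\<close> by blast
      have "conj_by (inv s) y \<in> N n" using Nconj y mono[OF \<open>n0 \<le> n\<close>] by blast
      moreover have "x = s \<otimes> conj_by (inv s) y" using y by (simp add: word_simps)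
      ultimately show ?thesis using y(2) by (auto simp: set_mult_def)
    qed
    moreover have "S <#> N n \<subseteq> M" using SM NM[of n] by (auto simp: set_mult_def)
    ultimately show "M = S <#> N n" by blast
  qed
  then show ?thesis unfolding M_def by blast
qed

end

theorem mainTheorem15:
  fixes G :: "('a, 'b) monoid_scheme" and T :: "'a topology" and N :: "nat \<Rightarrow> 'a set"
  assumes "locally_compact_group G T"
    and "compactly_generated G T"
    and "metabelian G"
    and "\<And>n. N n \<lhd> G"
    and "\<And>n. closedin T (N n)"
    and "\<And>n. N n \<subseteq> N (Suc n)"
  shows "\<exists>n0. \<forall>n\<ge>n0. cocompact_in G T (N n) (T closure_of (\<Union>n. N n))"
proof -
  interpret group G
    using assms(1) by (simp add: locally_compact_group_def topological_group_def)
  interpret lc_group G T by unfold_locales (rule assms(1))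
  show ?thesis by (rule eventually_cocompact[of N, OF assms(2-4,6)])
qed

end
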